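(* Let $(E,\rho_E,[\cdot,\cdot]_E,J_E,g)$ be an almost Hermitian Lie algebroid over a smooth manifold $M$. The mean curvature section $H^{0,1}$ of $E^{0,1}$ is zero. The second fundamental form section $B^{0,1}$ of $E^{0,1}$ vanishes if and only if $(E,\rho_E,[\cdot,\cdot]_E,J_E,g)$ is Hermitian.
   Context: A Lie algebroid $(E,\rho_E,[\cdot,\cdot]_E)$ over a smooth manifold $M$ is a real vector bundle $E\to M$ with a vector bundle morphism $\rho_E:E\to TM$ (the anchor) and a real Lie algebra bracket on $\Gamma(E)$ such that $\rho_E([s_1,s_2]_E)=[\rho_E(s_1),\rho_E(s_2)]$ and $[s_1,fs_2]_E=f[s_1,s_2]_E+\rho_E(s_1)(f)s_2$. An almost Hermitian Lie algebroid $(E,\rho_E,[\cdot,\cdot]_E,J_E,g)$ is a Lie algebroid of rank $2m$ with a vector bundle endomorphism $J_E$ of $E$ over the identity, $J_E^2=-\mathrm{id}$, and a Riemannian metric $g$ on $E$ with $g(J_Es_1,J_Es_2)=g(s_1,s_2)$. It is Hermitian if moreover $N_{J_E}=0$, where $N_{J_E}(s_1,s_2)=[J_Es_1,J_Es_2]_E-J_E[s_1,J_Es_2]_E-J_E[J_Es_1,s_2]_E-[s_1,s_2]_E$. The Levi-Civita connection $D$ of $g$ is the unique map $\Gamma(E)\times\Gamma(E)\to\Gamma(E)$, $\mathbb R$-bilinear, with $D_{fs_1}s_2=fD_{s_1}s_2$, $D_{s_1}(fs_2)=(\rho_E(s_1)f)s_2+fD_{s_1}s_2$, $\rho_E(s)(g(s_1,s_2))=g(D_ss_1,s_2)+g(s_1,D_ss_2)$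 and $D_{s_1}s_2-D_{s_2}s_1=[s_1,s_2]_E$. Let $E_{\mathbb C}=E\otimes\mathbb C$, with $\rho_E$, $[\cdot,\cdot]_E$, $J_E$, $g$, $D$ extended $\mathbb C$-(bi)linearly; $E^{1,0},E^{0,1}$ are the $+i$ and $-i$ eigenbundles of $J_E$, with projections $p^{1,0}=\frac12(I_E-iJ_E)$, $p^{0,1}=\frac12(I_E+iJ_E)$ ($I_E$ the identity). Let $h(s_1,s_2)=g(s_1,\overline{s_2})$, a Hermitian metric on $E_{\mathbb C}$. The second fundamental form section of $E^{0,1}$ is $$B^{0,1}(s_1,s_2)=p^{1,0}\big(D_{p^{0,1}s_1}p^{0,1}s_2\big)=-\tfrac12\big(D_{p^{0,1}s_1}J_E\big)J_E(p^{0,1}s_2),\quad s_1,s_2\in\Gamma(E_{\mathbb C}).$$ The mean curvature section of $E^{0,1}$ is $H^{0,1}=\mathrm{tr}\,B^{0,1}=\sum_{a}B^{0,1}(f_a,\overline{f_a})\in\Gamma(E^{1,0})$, where $\{f_a\}$ is an arbitrary $h$-unitary local basis of $E_{\mathbb C}$ (of $2m$ elements). *)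

theory Defs
  imports "HOL-Analysis.Analysis"
begin

section \<open>Smooth maps between open subsets of finite-dimensional spaces\<close>

primrec Ck_on :: "nat \<Rightarrow> 'a::real_normed_vector set \<Rightarrow> ('a \<Rightarrow> 'b::real_normed_vector) \<Rightarrow> bool" where
  "Ck_on 0 S f \<longleftrightarrow> continuous_on S f"
| "Ck_on (Suc k) S f \<longleftrightarrow>
     (\<exists>f'. (\<forall>x\<in>S. (f has_derivative f' x) (at x)) \<and> (\<forall>v. Ck_on k S (\<lambda>x. f' x v)))"

definition Cinf_on :: "'a::real_normed_vector set \<Rightarrow> ('a \<Rightarrow> 'b::real_normed_vector) \<Rightarrow> bool" where
  "Cinf_on S f \<longleftrightarrow> (\<forall>k. Ck_on k S f)"

section \<open>Smooth manifolds\<close>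

type_synonym ('m, 'e) chart = "'m set \<times> ('m \<Rightarrow> 'e)"

record ('m, 'e) mfd =
  atlas :: "('m, 'e) chart set"

text \<open>The manifold \<open>M\<close> is the whole type \<open>'m\<close>; its topology is the one of the type, Hausdorff and
  second countable by the sort constraint. The model space \<open>'e\<close> is a finite-dimensional inner
  product space; the class \<open>euclidean_space\<close> is avoided because it excludes dimension \<open>0\<close>.\<close>

definition smooth_manifold ::
  "('m::{second_countable_topology,t2_space}, 'e::real_inner, 'z) mfd_scheme \<Rightarrow> bool" where
  "smooth_manifold M \<longleftrightarrow>
     (\<exists>B::'e set. finite B \<and> span B = UNIV) \<and>
     (\<forall>(U, \<phi>)\<in>atlas M. open U \<and> open (\<phi> ` U) \<and> homeomorphism U (\<phi> ` U) \<phi> (inv_into U \<phi>)) \<and>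
     (\<Union>(U, \<phi>)\<in>atlas M. U) = UNIV \<and>
     (\<forall>(U, \<phi>)\<in>atlas M. \<forall>(V, \<psi>)\<in>atlas M. Cinf_on (\<phi> ` (U \<inter> V)) (\<psi> \<circ> inv_into U \<phi>))"

definition smooth_fun_on ::
  "('m, 'e::real_inner, 'z) mfd_scheme \<Rightarrow> 'm set \<Rightarrow> ('m \<Rightarrow> real) \<Rightarrow> bool" where
  "smooth_fun_on M U f \<longleftrightarrow> (\<forall>(V, \<phi>)\<in>atlas M. Cinf_on (\<phi> ` (U \<inter> V)) (f \<circ> inv_into V \<phi>))"

abbreviation smooth_funs :: "('m, 'e::real_inner, 'z) mfd_scheme \<Rightarrow> ('m \<Rightarrow> real) set" where
  "smooth_funs M \<equiv> {f. smooth_fun_on M UNIV f}"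

text \<open>Tangent vectors at \<open>x\<close> are derivations at \<open>x\<close> of the algebra of smooth functions; only the
  values on \<open>smooth_funs M\<close> carry meaning.\<close>

definition tangent_vector ::
  "('m, 'e::real_inner, 'z) mfd_scheme \<Rightarrow> 'm \<Rightarrow> (('m \<Rightarrow> real) \<Rightarrow> real) \<Rightarrow> bool" where
  "tangent_vector M x v \<longleftrightarrow>
     (\<forall>f\<in>smooth_funs M. \<forall>f'\<in>smooth_funs M.
        v (\<lambda>y. f y + f' y) = v f + v f' \<and>
        v (\<lambda>y. f y * f' y) = f x * v f' + f' x * v f) \<and>
     (\<forall>f\<in>smooth_funs M. \<forall>c. v (\<lambda>y. c * f y) = c * v f)"

text \<open>The bracket of two vector fields, given as families of derivations.\<close>

definition vf_bracket ::
  "('m \<Rightarrow> ('m \<Rightarrow> real) \<Rightarrow> real) \<Rightarrow> ('m \<Rightarrow> ('m \<Rightarrow> real) \<Rightarrow> real) \<Rightarrow> 'm \<Rightarrow> ('m \<Rightarrow> real) \<Rightarrow> real" where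
  "vf_bracket X Y = (\<lambda>x f. X x (\<lambda>y. Y y f) - Y x (\<lambda>y. X y f))"

section \<open>Vector bundles\<close>

text \<open>The fibres are subspaces of one real vector space \<open>'v\<close>. This is no restriction, since the
  fibres of any bundle embed into their direct sum; no topology on \<open>'v\<close> is used. A local
  trivialization over \<open>U\<close> is given by the corresponding frame \<open>e 0, \<dots>, e (rk - 1)\<close>.\<close>

record ('m, 'e, 'v) vbundle = "('m, 'e) mfd" +
  fibre :: "'m \<Rightarrow> 'v set"
  rk :: nat
  frames :: "('m set \<times> (nat \<Rightarrow> 'm \<Rightarrow> 'v)) set"

text \<open>Smooth sections over an open set \<open>U\<close>: the coefficients in the distinguished frames are
  smooth.\<close>

definition sections_on ::
  "('m, 'e::real_inner, 'v::real_vector, 'z) vbundle_scheme \<Rightarrow> 'm set \<Rightarrow> ('m \<Rightarrow> 'v) set" where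
  "sections_on E U = {s. (\<forall>x\<in>U. s x \<in> fibre E x) \<and>
     (\<forall>(V, e)\<in>frames E. \<exists>c. (\<forall>i<rk E. smooth_fun_on E (U \<inter> V) (c i)) \<and>
        (\<forall>x\<in>U \<inter> V. s x = (\<Sum>i<rk E. c i x *\<^sub>R e i x)))}"

abbreviation sections ::
  "('m, 'e::real_inner, 'v::real_vector, 'z) vbundle_scheme \<Rightarrow> ('m \<Rightarrow> 'v) set" where
  "sections E \<equiv> sections_on E UNIV"

text \<open>The last condition says that the transition functions between the frames are smooth.\<close>

definition vector_bundle ::
  "('m::{second_countable_topology,t2_space}, 'e::real_inner, 'v::real_vector, 'z) vbundle_scheme
     \<Rightarrow> bool" where
  "vector_bundle E \<longleftrightarrow> smooth_manifold E \<and>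
     (\<forall>(U, e)\<in>frames E. open U \<and>
        (\<forall>x\<in>U. inj_on (\<lambda>i. e i x) {..<rk E} \<and> independent ((\<lambda>i. e i x) ` {..<rk E}) \<and>
               span ((\<lambda>i. e i x) ` {..<rk E}) = fibre E x)) \<and>
     (\<Union>(U, e)\<in>frames E. U) = UNIV \<and>
     (\<forall>(U, e)\<in>frames E. \<forall>i<rk E. e i \<in> sections_on E U)"

text \<open>Smoothness of a fibrewise linear map, or of a fibre metric, is expressed by its action on
  local smooth sections, which amounts to smoothness of its matrices in local frames.\<close>

definition bundle_endomorphism ::
  "('m::{second_countable_topology,t2_space}, 'e::real_inner, 'v::real_vector, 'z) vbundle_scheme
     \<Rightarrow> ('m \<Rightarrow> 'v \<Rightarrow> 'v) \<Rightarrow> bool" where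
  "bundle_endomorphism E A \<longleftrightarrow>
     (\<forall>x. \<forall>u\<in>fibre E x. A x u \<in> fibre E x \<and>
        (\<forall>c. A x (c *\<^sub>R u) = c *\<^sub>R A x u) \<and>
        (\<forall>v\<in>fibre E x. A x (u + v) = A x u + A x v)) \<and>
     (\<forall>U s. open U \<and> s \<in> sections_on E U \<longrightarrow> (\<lambda>x. A x (s x)) \<in> sections_on E U)"

definition bundle_map_to_tangent ::
  "('m::{second_countable_topology,t2_space}, 'e::real_inner, 'v::real_vector, 'z) vbundle_scheme
     \<Rightarrow> ('m \<Rightarrow> 'v \<Rightarrow> ('m \<Rightarrow> real) \<Rightarrow> real) \<Rightarrow> bool" where
  "bundle_map_to_tangent E \<rho> \<longleftrightarrow>
     (\<forall>x. \<forall>u\<in>fibre E x. tangent_vector E x (\<rho> x u)) \<and>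
     (\<forall>x. \<forall>u\<in>fibre E x. \<forall>f\<in>smooth_funs E.
        (\<forall>c. \<rho> x (c *\<^sub>R u) f = c * \<rho> x u f) \<and>
        (\<forall>v\<in>fibre E x. \<rho> x (u + v) f = \<rho> x u f + \<rho> x v f)) \<and>
     (\<forall>U s. open U \<and> s \<in> sections_on E U \<longrightarrow>
        (\<forall>f\<in>smooth_funs E. smooth_fun_on E U (\<lambda>x. \<rho> x (s x) f)))"

definition riemannian_metric ::
  "('m::{second_countable_topology,t2_space}, 'e::real_inner, 'v::real_vector, 'z) vbundle_scheme
     \<Rightarrow> ('m \<Rightarrow> 'v \<Rightarrow> 'v \<Rightarrow> real) \<Rightarrow> bool" where
  "riemannian_metric E g \<longleftrightarrow>
     (\<forall>x. \<forall>u\<in>fibre E x. \<forall>v\<in>fibre E x. g x u v = g x v u \<and>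
        (\<forall>c. g x (c *\<^sub>R u) v = c * g x u v) \<and>
        (\<forall>w\<in>fibre E x. g x (u + w) v = g x u v + g x w v)) \<and>
     (\<forall>x. \<forall>u\<in>fibre E x. u \<noteq> 0 \<longrightarrow> g x u u > 0) \<and>
     (\<forall>U s t. open U \<and> s \<in> sections_on E U \<and> t \<in> sections_on E U \<longrightarrow>
        smooth_fun_on E U (\<lambda>x. g x (s x) (t x)))"

text \<open>An \<open>\<real>\<close>-bilinear map \<open>\<Gamma>(E) \<times> \<Gamma>(E) \<rightarrow> \<Gamma>(E)\<close>.\<close>

definition bilinear_on_sections ::
  "('m, 'e::real_inner, 'v::real_vector, 'z) vbundle_scheme
     \<Rightarrow> (('m \<Rightarrow> 'v) \<Rightarrow> ('m \<Rightarrow> 'v) \<Rightarrow> 'm \<Rightarrow> 'v) \<Rightarrow> bool" where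
  "bilinear_on_sections E F \<longleftrightarrow>
     (\<forall>s\<in>sections E. \<forall>t\<in>sections E. F s t \<in> sections E \<and>
        (\<forall>c. F (\<lambda>x. c *\<^sub>R s x) t = (\<lambda>x. c *\<^sub>R F s t x) \<and>
             F s (\<lambda>x. c *\<^sub>R t x) = (\<lambda>x. c *\<^sub>R F s t x)) \<and>
        (\<forall>r\<in>sections E. F (\<lambda>x. s x + r x) t = (\<lambda>x. F s t x + F r t x) \<and>
                        F s (\<lambda>x. t x + r x) = (\<lambda>x. F s t x + F s r x)))"

section \<open>Almost Hermitian Lie algebroids\<close>

record ('m, 'e, 'v) lie_algd = "('m, 'e, 'v) vbundle" +
  anchor :: "'m \<Rightarrow> 'v \<Rightarrow> ('m \<Rightarrow> real) \<Rightarrow> real"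
  bracket :: "('m \<Rightarrow> 'v) \<Rightarrow> ('m \<Rightarrow> 'v) \<Rightarrow> 'm \<Rightarrow> 'v"

definition lie_algebroid ::
  "('m::{second_countable_topology,t2_space}, 'e::real_inner, 'v::real_vector, 'z) lie_algd_scheme
     \<Rightarrow> bool" where
  "lie_algebroid E \<longleftrightarrow> vector_bundle E \<and>
     bundle_map_to_tangent E (anchor E) \<and>
     bilinear_on_sections E (bracket E) \<and>
     (\<forall>s\<in>sections E. bracket E s s = (\<lambda>x. 0)) \<and>
     (\<forall>r\<in>sections E. \<forall>s\<in>sections E. \<forall>t\<in>sections E.
        (\<lambda>x. bracket E r (bracket E s t) x + bracket E s (bracket E t r) x
           + bracket E t (bracket E r s) x) = (\<lambda>x. 0)) \<and>
     (\<forall>s\<in>sections E. \<forall>t\<in>sections E. \<forall>x. \<forall>f\<in>smooth_funs E.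
        anchor E x (bracket E s t x) f =
          vf_bracket (\<lambda>y. anchor E y (s y)) (\<lambda>y. anchor E y (t y)) x f) \<and>
     (\<forall>s\<in>sections E. \<forall>t\<in>sections E. \<forall>f\<in>smooth_funs E.
        bracket E s (\<lambda>x. f x *\<^sub>R t x) =
          (\<lambda>x. f x *\<^sub>R bracket E s t x + anchor E x (s x) f *\<^sub>R t x))"

record ('m, 'e, 'v) ah_lie_algd = "('m, 'e, 'v) lie_algd" +
  acs :: "'m \<Rightarrow> 'v \<Rightarrow> 'v"
  metric :: "'m \<Rightarrow> 'v \<Rightarrow> 'v \<Rightarrow> real"

definition almost_hermitian_lie_algebroid ::
  "('m::{second_countable_topology,t2_space}, 'e::real_inner, 'v::real_vector, 'z)
     ah_lie_algd_scheme \<Rightarrow> bool" where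
  "almost_hermitian_lie_algebroid E \<longleftrightarrow> lie_algebroid E \<and>
     (\<exists>m. rk E = 2 * m) \<and>
     bundle_endomorphism E (acs E) \<and>
     (\<forall>x. \<forall>u\<in>fibre E x. acs E x (acs E x u) = - u) \<and>
     riemannian_metric E (metric E) \<and>
     (\<forall>x. \<forall>u\<in>fibre E x. \<forall>v\<in>fibre E x.
        metric E x (acs E x u) (acs E x v) = metric E x u v)"

definition nijenhuis ::
  "('m, 'e, 'v::real_vector, 'z) ah_lie_algd_scheme \<Rightarrow> ('m \<Rightarrow> 'v) \<Rightarrow> ('m \<Rightarrow> 'v) \<Rightarrow> 'm \<Rightarrow> 'v" where
  "nijenhuis E s t =
     (let Js = (\<lambda>y. acs E y (s y)); Jt = (\<lambda>y. acs E y (t y)) in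
      (\<lambda>x. bracket E Js Jt x - acs E x (bracket E s Jt x) - acs E x (bracket E Js t x)
           - bracket E s t x))"

definition hermitian_lie_algebroid ::
  "('m::{second_countable_topology,t2_space}, 'e::real_inner, 'v::real_vector, 'z)
     ah_lie_algd_scheme \<Rightarrow> bool" where
  "hermitian_lie_algebroid E \<longleftrightarrow> almost_hermitian_lie_algebroid E \<and>
     (\<forall>s\<in>sections E. \<forall>t\<in>sections E. nijenhuis E s t = (\<lambda>x. 0))"

definition levi_civita ::
  "('m::{second_countable_topology,t2_space}, 'e::real_inner, 'v::real_vector, 'z)
     ah_lie_algd_scheme \<Rightarrow> (('m \<Rightarrow> 'v) \<Rightarrow> ('m \<Rightarrow> 'v) \<Rightarrow> 'm \<Rightarrow> 'v) \<Rightarrow> bool" where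
  "levi_civita E D \<longleftrightarrow> bilinear_on_sections E D \<and>
     (\<forall>s\<in>sections E. \<forall>t\<in>sections E. \<forall>f\<in>smooth_funs E.
        D (\<lambda>x. f x *\<^sub>R s x) t = (\<lambda>x. f x *\<^sub>R D s t x) \<and>
        D s (\<lambda>x. f x *\<^sub>R t x) = (\<lambda>x. anchor E x (s x) f *\<^sub>R t x + f x *\<^sub>R D s t x)) \<and>
     (\<forall>r\<in>sections E. \<forall>s\<in>sections E. \<forall>t\<in>sections E. \<forall>x.
        anchor E x (r x) (\<lambda>y. metric E y (s y) (t y)) =
          metric E x (D r s x) (t x) + metric E x (s x) (D r t x)) \<and>
     (\<forall>s\<in>sections E. \<forall>t\<in>sections E. (\<lambda>x. D s t x - D t s x) = bracket E s t)"

section \<open>Complexification\<close>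

text \<open>The element \<open>u + i v\<close> of \<open>E \<otimes> \<complex>\<close> is represented by the pair \<open>(u, v)\<close>.\<close>

definition cscale :: "complex \<Rightarrow> 'v::real_vector \<times> 'v \<Rightarrow> 'v \<times> 'v" where
  "cscale c w = (Re c *\<^sub>R fst w - Im c *\<^sub>R snd w, Re c *\<^sub>R snd w + Im c *\<^sub>R fst w)"

definition cconj :: "'v::real_vector \<times> 'v \<Rightarrow> 'v \<times> 'v" where
  "cconj w = (fst w, - snd w)"

definition cfibre :: "('m, 'e, 'v, 'z) vbundle_scheme \<Rightarrow> 'm \<Rightarrow> ('v \<times> 'v) set" where
  "cfibre E x = fibre E x \<times> fibre E x"

definition csections_on ::
  "('m, 'e::real_inner, 'v::real_vector, 'z) vbundle_scheme \<Rightarrow> 'm set \<Rightarrow> ('m \<Rightarrow> 'v \<times> 'v) set" where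
  "csections_on E U = {s. fst \<circ> s \<in> sections_on E U \<and> snd \<circ> s \<in> sections_on E U}"

abbreviation csections ::
  "('m, 'e::real_inner, 'v::real_vector, 'z) vbundle_scheme \<Rightarrow> ('m \<Rightarrow> 'v \<times> 'v) set" where
  "csections E \<equiv> csections_on E UNIV"

definition cacs :: "('m, 'e, 'v, 'z) ah_lie_algd_scheme \<Rightarrow> 'm \<Rightarrow> 'v \<times> 'v \<Rightarrow> 'v \<times> 'v" where
  "cacs E x w = (acs E x (fst w), acs E x (snd w))"

definition cmetric ::
  "('m, 'e, 'v, 'z) ah_lie_algd_scheme \<Rightarrow> 'm \<Rightarrow> 'v \<times> 'v \<Rightarrow> 'v \<times> 'v \<Rightarrow> complex" where
  "cmetric E x w z =
     Complex (metric E x (fst w) (fst z) - metric E x (snd w) (snd z))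
             (metric E x (fst w) (snd z) + metric E x (snd w) (fst z))"

definition hmetric ::
  "('m, 'e, 'v::real_vector, 'z) ah_lie_algd_scheme \<Rightarrow> 'm \<Rightarrow> 'v \<times> 'v \<Rightarrow> 'v \<times> 'v \<Rightarrow> complex" where
  "hmetric E x w z = cmetric E x w (cconj z)"

definition cconnection ::
  "(('m \<Rightarrow> 'v) \<Rightarrow> ('m \<Rightarrow> 'v) \<Rightarrow> 'm \<Rightarrow> 'v::real_vector)
     \<Rightarrow> ('m \<Rightarrow> 'v \<times> 'v) \<Rightarrow> ('m \<Rightarrow> 'v \<times> 'v) \<Rightarrow> 'm \<Rightarrow> 'v \<times> 'v" where
  "cconnection D s t =
     (\<lambda>x. (D (fst \<circ> s) (fst \<circ> t) x - D (snd \<circ> s) (snd \<circ> t) x,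
           D (fst \<circ> s) (snd \<circ> t) x + D (snd \<circ> s) (fst \<circ> t) x))"

definition proj10 ::
  "('m, 'e, 'v::real_vector, 'z) ah_lie_algd_scheme \<Rightarrow> 'm \<Rightarrow> 'v \<times> 'v \<Rightarrow> 'v \<times> 'v" where
  "proj10 E x w = cscale (1/2) (w - cscale \<i> (cacs E x w))"

definition proj01 ::
  "('m, 'e, 'v::real_vector, 'z) ah_lie_algd_scheme \<Rightarrow> 'm \<Rightarrow> 'v \<times> 'v \<Rightarrow> 'v \<times> 'v" where
  "proj01 E x w = cscale (1/2) (w + cscale \<i> (cacs E x w))"

section \<open>Second fundamental form and mean curvature of \<open>E\<^sup>0\<^sup>,\<^sup>1\<close>\<close>

definition B01 ::
  "('m, 'e, 'v::real_vector, 'z) ah_lie_algd_scheme \<Rightarrow> (('m \<Rightarrow> 'v) \<Rightarrow> ('m \<Rightarrow> 'v) \<Rightarrow> 'm \<Rightarrow> 'v)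
     \<Rightarrow> ('m \<Rightarrow> 'v \<times> 'v) \<Rightarrow> ('m \<Rightarrow> 'v \<times> 'v) \<Rightarrow> 'm \<Rightarrow> 'v \<times> 'v" where
  "B01 E D s t =
     (\<lambda>x. proj10 E x (cconnection D (\<lambda>y. proj01 E y (s y)) (\<lambda>y. proj01 E y (t y)) x))"

text \<open>\<open>B01\<close> is a local operator. Its value at \<open>x\<close> on sections \<open>s\<close>, \<open>t\<close> defined only near \<open>x\<close> is
  computed with any global sections having the same germs at \<open>x\<close>.\<close>

definition B01_local ::
  "('m::topological_space, 'e::real_inner, 'v::real_vector, 'z) ah_lie_algd_scheme
     \<Rightarrow> (('m \<Rightarrow> 'v) \<Rightarrow> ('m \<Rightarrow> 'v) \<Rightarrow> 'm \<Rightarrow> 'v)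
     \<Rightarrow> ('m \<Rightarrow> 'v \<times> 'v) \<Rightarrow> ('m \<Rightarrow> 'v \<times> 'v) \<Rightarrow> 'm \<Rightarrow> 'v \<times> 'v" where
  "B01_local E D s t x =
     (THE w. \<forall>s'\<in>csections E. \<forall>t'\<in>csections E.
        eventually (\<lambda>y. s' y = s y \<and> t' y = t y) (nhds x) \<longrightarrow> w = B01 E D s' t' x)"

definition unitary_local_basis ::
  "('m::topological_space, 'e::real_inner, 'v::real_vector, 'z) ah_lie_algd_scheme
     \<Rightarrow> 'm set \<Rightarrow> (nat \<Rightarrow> 'm \<Rightarrow> 'v \<times> 'v) \<Rightarrow> bool" where
  "unitary_local_basis E U f \<longleftrightarrow> open U \<and>
     (\<forall>a<rk E. f a \<in> csections_on E U) \<and>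
     (\<forall>x\<in>U. (\<forall>a<rk E. \<forall>b<rk E. hmetric E x (f a x) (f b x) = (if a = b then 1 else 0)) \<and>
            (\<forall>w\<in>cfibre E x. \<exists>c. w = (\<Sum>a<rk E. cscale (c a) (f a x))))"

definition H01 ::
  "('m::topological_space, 'e::real_inner, 'v::real_vector, 'z) ah_lie_algd_scheme
     \<Rightarrow> (('m \<Rightarrow> 'v) \<Rightarrow> ('m \<Rightarrow> 'v) \<Rightarrow> 'm \<Rightarrow> 'v) \<Rightarrow> 'm \<Rightarrow> 'v \<times> 'v" where
  "H01 E D x =
     (THE w. \<forall>U f. x \<in> U \<and> unitary_local_basis E U f \<longrightarrow>
        w = (\<Sum>a<rk E. B01_local E D (f a) (\<lambda>y. cconj (f a y)) x))"

end

theory Submission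
  imports Defs "HOL-Real_Asymp.Real_Asymp"
begin

text \<open>
  Both assertions are statements about one real tensor. If \<open>a\<close>, \<open>b\<close> are sections of \<open>E\<close>, put
  \<open>Z a b = D\<^sub>a b + J D\<^sub>a (J b) + J D\<^bsub>J a\<^esub> b - D\<^bsub>J a\<^esub> (J b)\<close>. Up to the factor \<open>1 / 8\<close>, this is
  the real part of \<open>B\<^sup>0\<^sup>,\<^sup>1\<close> at sections of \<open>E\<^sub>\<complex>\<close> whose projections to \<open>E\<^sup>0\<^sup>,\<^sup>1\<close> are
  \<open>(a + i J a) / 2\<close> and \<open>(b + i J b) / 2\<close>, and the real part determines the imaginary part
  (\<open>B01_eq_Z\<close>); so \<open>B\<^sup>0\<^sup>,\<^sup>1\<close> vanishes exactly if \<open>Z\<close> does. The derivative terms cancel in \<open>Z\<close>,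
  which is therefore bilinear over the smooth functions.

  Hermitian case. The connection has no torsion, so the Nijenhuis tensor at \<open>s\<close>, \<open>t\<close> is
  \<open>Z t s - Z s t\<close>: it vanishes exactly if \<open>Z\<close> is symmetric. The connection is metric and \<open>J\<close> is
  skew, so \<open>g (Z a b, c)\<close> is skew in \<open>b\<close>, \<open>c\<close>. A trilinear form which is symmetric in the first
  two and skew in the last two arguments is zero (\<open>nijenhuis_zero_iff_Z_zero\<close>).

  Mean curvature. \<open>B\<^sup>0\<^sup>,\<^sup>1\<close> is complex bilinear, and replacing one argument by its image under \<open>J\<close>
  multiplies the value by \<open>- i\<close>. For a unitary basis \<open>f\<close>, the expansions of \<open>J f\<^sub>a\<close> and of
  \<open>J\<close> applied to the conjugate of \<open>f\<^sub>b\<close> have coefficients \<open>h (J f\<^sub>a, f\<^sub>b)\<close> and \<open>- h (J f\<^sub>a, f\<^sub>b)\<close>, because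
  this matrix is skew-Hermitian. Hence \<open>- i\<close> times the trace equals \<open>i\<close> times the trace, and the
  trace is zero (\<open>trace_B01_eq_zero\<close>).

  The mean curvature is the common value of the traces over all unitary local bases, and the second
  fundamental form of local sections is that of any global sections with the same germs. For these
  to be well defined, local sections must extend up to their germ, \<open>B\<^sup>0\<^sup>,\<^sup>1\<close> must depend only on germs,
  and a unitary local basis must exist near each point. The first two follow from bump functions
  (\<open>bump_function\<close>, \<open>section_extension\<close>, \<open>B01_germ\<close>), the third from smooth Gram--Schmidt
  orthonormalization of a frame (\<open>gram_schmidt_frame\<close>).
\<close>

section \<open>Calculus of maps of class \<open>C\<^sup>k\<close>\<close>

lemma Ck_on_SucI:
  assumes "\<And>x. x \<in> S \<Longrightarrow> (f has_derivative f' x) (at x)" "\<And>v. Ck_on k S (\<lambda>x. f' x v)"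
  shows "Ck_on (Suc k) S f"
  using assms by auto

lemma Ck_on_SucE:
  assumes "Ck_on (Suc k) S f"
  obtains f' where "\<And>x. x \<in> S \<Longrightarrow> (f has_derivative f' x) (at x)" "\<And>v. Ck_on k S (\<lambda>x. f' x v)"
  using assms by auto

lemma Ck_on_subset:
  assumes "Ck_on k S f" "T \<subseteq> S"
  shows "Ck_on k T f"
  using assms(1)
proof (induction k arbitrary: f)
  case 0
  then show ?case using assms(2) by (auto intro: continuous_on_subset)
next
  case (Suc k)
  then show ?case using assms(2) by (elim Ck_on_SucE, intro Ck_on_SucI) auto
qed

lemma Ck_on_Suc_imp_Ck_on: "Ck_on (Suc k) S f \<Longrightarrow> Ck_on k S f"
proof (induction k arbitrary: f)
  case 0
  then show ?case
    by (elim Ck_on_SucE) (auto intro!: continuous_at_imp_continuous_on has_derivative_continuous)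
next
  case (Suc k)
  from Suc.prems show ?case
    by (elim Ck_on_SucE, intro Ck_on_SucI) (auto intro: Suc.IH simp del: Ck_on.simps)
qed

lemma Ck_on_const: "Ck_on k S (\<lambda>x. c)"
proof (induction k arbitrary: c)
  case (Suc k)
  then show ?case by (intro Ck_on_SucI[where f' = "\<lambda>x v. 0"]) auto
qed auto

lemma Ck_on_add:
  assumes "Ck_on k S f" "Ck_on k S g"
  shows "Ck_on k S (\<lambda>x. f x + g x)"
  using assms
proof (induction k arbitrary: f g)
  case 0
  then show ?case by (auto intro: continuous_intros)
next
  case (Suc k)
  from Suc.prems(1) obtain f' where f: "\<And>x. x \<in> S \<Longrightarrow> (f has_derivative f' x) (at x)"
    "\<And>v. Ck_on k S (\<lambda>x. f' x v)" unfolding Ck_on.simps by blast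
  from Suc.prems(2) obtain g' where g: "\<And>x. x \<in> S \<Longrightarrow> (g has_derivative g' x) (at x)"
    "\<And>v. Ck_on k S (\<lambda>x. g' x v)" unfolding Ck_on.simps by blast
  show ?case
    by (rule Ck_on_SucI[where f' = "\<lambda>x v. f' x v + g' x v"])
      (auto intro!: has_derivative_add Suc.IH f g)
qed

lemma (in bounded_bilinear) Ck_on_prod:
  assumes "Ck_on k S f" "Ck_on k S g"
  shows "Ck_on k S (\<lambda>x. prod (f x) (g x))"
  using assms
proof (induction k arbitrary: f g)
  case 0
  then show ?case by (auto intro: continuous_on)
next
  case (Suc k)
  from Suc.prems(1) obtain f' where f: "\<And>x. x \<in> S \<Longrightarrow> (f has_derivative f' x) (at x)"
    "\<And>v. Ck_on k S (\<lambda>x. f' x v)" unfolding Ck_on.simps by blast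
  from Suc.prems(2) obtain g' where g: "\<And>x. x \<in> S \<Longrightarrow> (g has_derivative g' x) (at x)"
    "\<And>v. Ck_on k S (\<lambda>x. g' x v)" unfolding Ck_on.simps by blast
  show ?case
    by (rule Ck_on_SucI[where f' = "\<lambda>x v. prod (f x) (g' x v) + prod (f' x v) (g x)"])
      (auto intro!: FDERIV Ck_on_add Suc.IH f g Ck_on_Suc_imp_Ck_on[OF Suc.prems(1)]
        Ck_on_Suc_imp_Ck_on[OF Suc.prems(2)])
qed

lemma Ck_on_compose_real:
  fixes \<phi> :: "real \<Rightarrow> 'b::real_normed_vector"
  assumes "Ck_on k T \<phi>" "Ck_on k S f" "f ` S \<subseteq> T"
  shows "Ck_on k S (\<lambda>x. \<phi> (f x))"
  using assms(1,2)
proof (induction k arbitrary: \<phi>)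
  case 0
  then show ?case using assms(3) by (auto intro: continuous_on_compose2)
next
  case (Suc k)
  from Suc.prems(1) obtain \<phi>' where \<phi>: "\<And>x. x \<in> T \<Longrightarrow> (\<phi> has_derivative \<phi>' x) (at x)"
    "\<And>v. Ck_on k T (\<lambda>x. \<phi>' x v)" unfolding Ck_on.simps by blast
  from Suc.prems(2) obtain f' where f: "\<And>x. x \<in> S \<Longrightarrow> (f has_derivative f' x) (at x)"
    "\<And>v. Ck_on k S (\<lambda>x. f' x v)" unfolding Ck_on.simps by blast
  show ?case
  proof (rule Ck_on_SucI[where f' = "\<lambda>x v. f' x v *\<^sub>R \<phi>' (f x) 1"])
    fix x assume x: "x \<in> S"
    with assms(3) have fx: "f x \<in> T" by auto
    interpret bounded_linear "\<phi>' (f x)" using \<phi>(1)[OF fx] by (rule has_derivative_bounded_linear)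
    have "\<phi>' (f x) (f' x v) = f' x v *\<^sub>R \<phi>' (f x) 1" for v
      using scaleR[of "f' x v" 1] by simp
    then show "((\<lambda>x. \<phi> (f x)) has_derivative (\<lambda>v. f' x v *\<^sub>R \<phi>' (f x) 1)) (at x)"
      using has_derivative_compose[OF f(1)[OF x] \<phi>(1)[OF fx]] by simp
  next
    fix v
    show "Ck_on k S (\<lambda>x. f' x v *\<^sub>R \<phi>' (f x) 1)"
      by (intro bounded_bilinear.Ck_on_prod[OF bounded_bilinear_scaleR] f
          Suc.IH \<phi> Ck_on_Suc_imp_Ck_on[OF Suc.prems(2)])
  qed
qed

text \<open>Being of class \<open>C\<^sup>k\<close> is a local property. The derivatives of the local representatives glue because
  a derivative at a point is unique.\<close>

lemma Ck_on_locally: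
  assumes "\<And>x. x \<in> S \<Longrightarrow> \<exists>T h. open T \<and> x \<in> T \<and> Ck_on k T h \<and> (\<forall>y\<in>T. f y = h y)"
  shows "Ck_on k S f"
  using assms
proof (induction k arbitrary: f)
  case 0
  have "continuous (at x) f" if "x \<in> S" for x
  proof -
    obtain T h where "open T" "x \<in> T" "continuous_on T h" "\<forall>y\<in>T. f y = h y"
      using 0[OF \<open>x \<in> S\<close>] by auto
    then have "continuous_on T f" using continuous_on_cong by blast
    then show ?thesis using \<open>open T\<close> \<open>x \<in> T\<close> continuous_on_eq_continuous_at by blast
  qed
  then show ?case by (auto intro: continuous_at_imp_continuous_on)
next
  case (Suc k)
  let ?D = "\<lambda>x. frechet_derivative f (at x)"
  have loc: "\<exists>T h'. open T \<and> x \<in> T \<and> (\<forall>y\<in>T. (f has_derivative h' y) (at y)) \<and>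
      (\<forall>v. Ck_on k T (\<lambda>y. h' y v))" if "x \<in> S" for x
  proof -
    obtain T h where T: "open T" "x \<in> T" "Ck_on (Suc k) T h" "\<forall>y\<in>T. f y = h y"
      using Suc.prems[OF \<open>x \<in> S\<close>] by blast
    from T(3) obtain h' where h: "\<And>x. x \<in> T \<Longrightarrow> (h has_derivative h' x) (at x)"
      "\<And>v. Ck_on k T (\<lambda>x. h' x v)" unfolding Ck_on.simps by blast
    have "\<forall>y\<in>T. (f has_derivative h' y) (at y)"
      using has_derivative_transform_within_open[OF h(1) \<open>open T\<close>] T(4) by auto
    then show ?thesis using T h by blast
  qed
  show ?case
  proof (rule Ck_on_SucI[where f' = ?D])
    fix x assume "x \<in> S"
    then show "(f has_derivative ?D x) (at x)"
      using loc frechet_derivative_at by metis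
  next
    fix v
    show "Ck_on k S (\<lambda>x. ?D x v)"
    proof (rule Suc.IH)
      fix x assume "x \<in> S"
      from loc[OF this] obtain T h' where "open T" "x \<in> T" "\<forall>y\<in>T. (f has_derivative h' y) (at y)"
        "\<forall>v. Ck_on k T (\<lambda>y. h' y v)" by blast
      then show "\<exists>T h. open T \<and> x \<in> T \<and> Ck_on k T h \<and> (\<forall>y\<in>T. ?D y v = h y)"
        by (intro exI[of _ T] exI[of _ "\<lambda>y. h' y v"]) (metis frechet_derivative_at)
    qed
  qed
qed

lemma Ck_on_powr: "Ck_on k {0<..} (\<lambda>t::real. t powr a)"
proof (induction k arbitrary: a)
  case 0
  then show ?case by (auto intro!: continuous_intros)
next
  case (Suc k)
  show ?case
  proof (rule Ck_on_SucI[where f' = "\<lambda>t v. v * (a * t powr (a - 1))"])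
    fix t :: real assume "t \<in> {0<..}"
    then have "((\<lambda>t. t powr a) has_real_derivative a * t powr (a - 1)) (at t)"
      by (auto intro!: derivative_eq_intros)
    then show "((\<lambda>t. t powr a) has_derivative (\<lambda>v. v * (a * t powr (a - 1)))) (at t)"
      by (simp add: has_field_derivative_def mult.commute[of _ "a * t powr (a - 1)"])
  next
    fix v :: real
    show "Ck_on k {0<..} (\<lambda>t. v * (a * t powr (a - 1)))"
      by (intro bounded_bilinear.Ck_on_prod[OF bounded_bilinear_mult] Ck_on_const Suc.IH)
  qed
qed

text \<open>The functions \<open>t\<^sup>-\<^sup>n exp (- 1 / t)\<close>, extended by \<open>0\<close> to \<open>t \<le> 0\<close>: their derivatives are linear
  combinations of functions of the same form.\<close>

definition flat_fun :: "nat \<Rightarrow> real \<Rightarrow> real" where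
  "flat_fun n t = (if t \<le> 0 then 0 else exp (- 1 / t) / t ^ n)"

lemma DERIV_flat_fun:
  "(flat_fun n has_real_derivative (flat_fun (n + 2) t - real n * flat_fun (n + 1) t)) (at t)"
proof -
  consider "t < 0" | "t = 0" | "t > 0" by linarith
  then show ?thesis
  proof cases
    case 1
    have "((\<lambda>_. 0) has_real_derivative 0) (at t)" by simp
    then have "(flat_fun n has_real_derivative 0) (at t)"
      by (rule has_field_derivative_transform_within_open[where S = "{..<0}"])
        (use 1 in \<open>auto simp: flat_fun_def\<close>)
    with 1 show ?thesis by (simp add: flat_fun_def)
  next
    case 2
    have "((\<lambda>h::real. exp (- 1 / h) / h ^ n / h) \<longlongrightarrow> 0) (at_right 0)"
      by real_asymp
    then have r: "((\<lambda>h. flat_fun n h / h) \<longlongrightarrow> 0) (at_right 0)"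
      by (rule Lim_transform_eventually)
        (auto simp: flat_fun_def eventually_at_right_less intro!: eventually_at_rightI[of 0 1])
    have "((\<lambda>h. flat_fun n h / h) \<longlongrightarrow> 0) (at_left 0)"
      by (rule Lim_transform_eventually[where f = "\<lambda>_. 0"])
        (auto simp: flat_fun_def intro!: eventually_at_leftI[of "-1" 0])
    with r have "((\<lambda>h. flat_fun n h / h) \<longlongrightarrow> 0) (at 0)"
      by (simp add: filterlim_split_at)
    then show ?thesis using 2 by (simp add: DERIV_def) (simp add: flat_fun_def)
  next
    case 3
    have "((\<lambda>t. exp (- 1 / t)) has_real_derivative exp (- 1 / t) * (1 / t\<^sup>2)) (at t)"
      using 3 by (auto intro!: derivative_eq_intros simp: power2_eq_square)
    from DERIV_divide[OF this DERIV_pow[of n t]]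
    have "((\<lambda>t. exp (- 1 / t) / t ^ n) has_real_derivative
        (exp (- 1 / t) * (1 / t\<^sup>2) * t ^ n - exp (- 1 / t) * (real n * t ^ (n - Suc 0)))
          / (t ^ n * t ^ n)) (at t)"
      using 3 by simp
    also have "(exp (- 1 / t) * (1 / t\<^sup>2) * t ^ n - exp (- 1 / t) * (real n * t ^ (n - Suc 0)))
          / (t ^ n * t ^ n) = exp (- 1 / t) / t ^ (n + 2) - real n * (exp (- 1 / t) / t ^ (n + 1))"
      using 3 by (cases n) (simp_all add: field_simps power2_eq_square)
    finally have "((\<lambda>t. exp (- 1 / t) / t ^ n) has_real_derivative
        (exp (- 1 / t) / t ^ (n + 2) - real n * (exp (- 1 / t) / t ^ (n + 1)))) (at t)" .
    then have "(flat_fun n has_real_derivative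
        (exp (- 1 / t) / t ^ (n + 2) - real n * (exp (- 1 / t) / t ^ (n + 1)))) (at t)"
      by (rule has_field_derivative_transform_within_open[where S = "{0<..}"])
        (use 3 in \<open>auto simp: flat_fun_def\<close>)
    with 3 show ?thesis by (simp add: flat_fun_def)
  qed
qed

lemma Ck_on_flat_fun: "Ck_on k S (flat_fun n)"
proof (induction k arbitrary: n)
  case 0
  then show ?case
    using DERIV_flat_fun DERIV_continuous continuous_at_imp_continuous_on by (metis Ck_on.simps(1))
next
  case (Suc k)
  show ?case
  proof (rule Ck_on_SucI)
    fix t :: real
    show "(flat_fun n has_derivative
        (\<lambda>v. (flat_fun (n + 2) t + (- real n) * flat_fun (n + 1) t) * v)) (at t)"
      using DERIV_flat_fun[of n t] by (simp add: has_field_derivative_def)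
  next
    fix v :: real
    show "Ck_on k S (\<lambda>t. (flat_fun (n + 2) t + (- real n) * flat_fun (n + 1) t) * v)"
      by (intro bounded_bilinear.Ck_on_prod[OF bounded_bilinear_mult] Ck_on_const Suc.IH Ck_on_add)
  qed
qed

text \<open>A smooth step on the line, equal to \<open>1\<close> left of \<open>a\<close> and to \<open>0\<close> right of \<open>b\<close>.\<close>

lemma smooth_step_exists:
  fixes a b :: real
  assumes "a < b"
  obtains \<beta> :: "real \<Rightarrow> real" where "Cinf_on UNIV \<beta>" "\<And>t. t \<le> a \<Longrightarrow> \<beta> t = 1" "\<And>t. t \<ge> b \<Longrightarrow> \<beta> t = 0"
proof
  \<comment> \<open>The denominator is positive because \<open>a < b\<close>: at each \<open>t\<close>, one of the two arguments is positive.\<close>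
  let ?p = "\<lambda>t. flat_fun 0 (b + (- 1) * t)" and ?q = "\<lambda>t. flat_fun 0 (t + - a)"
  let ?\<beta> = "\<lambda>t. ?p t * (?p t + ?q t) powr (- 1)"
  have pos: "?p t + ?q t > 0" for t using assms by (auto simp: flat_fun_def add_pos_pos)
  have id: "Ck_on k S (\<lambda>t::real. t)" for k S
  proof (cases k)
    case (Suc j)
    show ?thesis unfolding Suc
      by (rule Ck_on_SucI[where f' = "\<lambda>x v. v"]) (auto intro: Ck_on_const)
  qed auto
  note mult = bounded_bilinear.Ck_on_prod[OF bounded_bilinear_mult]
  have p: "Ck_on k UNIV ?p" for k
    by (rule Ck_on_compose_real[OF Ck_on_flat_fun Ck_on_add[OF Ck_on_const mult[OF Ck_on_const id]] subset_UNIV])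
  have q: "Ck_on k UNIV ?q" for k
    by (rule Ck_on_compose_real[OF Ck_on_flat_fun Ck_on_add[OF id Ck_on_const] subset_UNIV])
  have "Ck_on k UNIV (\<lambda>t. (?p t + ?q t) powr (- 1))" for k
    by (rule Ck_on_compose_real[OF Ck_on_powr Ck_on_add[OF p q]]) (use pos in auto)
  then show "Cinf_on UNIV ?\<beta>" unfolding Cinf_on_def by (intro allI mult p)
  show "?\<beta> t = 1" if "t \<le> a" for t
    using that assms by (simp add: flat_fun_def powr_minus field_simps)
  show "?\<beta> t = 0" if "t \<ge> b" for t
    using that assms by (simp add: flat_fun_def)
qed

section \<open>Smooth functions and bump functions on manifolds\<close>

lemma chart_inverse:
  assumes "smooth_manifold M" "(U, \<phi>) \<in> atlas M"
  shows "open U" "open (\<phi> ` U)" "continuous_on U \<phi>" "continuous_on (\<phi> ` U) (inv_into U \<phi>)"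
    and "x \<in> U \<Longrightarrow> inv_into U \<phi> (\<phi> x) = x"
  using assms unfolding smooth_manifold_def homeomorphism_def by auto

lemma open_chart_image:
  assumes M: "smooth_manifold M" "(U, \<phi>) \<in> atlas M" and A: "open A"
  shows "open (\<phi> ` (A \<inter> U))"
proof -
  have "open (\<phi> ` U \<inter> inv_into U \<phi> -` A)"
    using chart_inverse[OF M] A by (intro continuous_open_preimage) auto
  also have "\<phi> ` U \<inter> inv_into U \<phi> -` A = \<phi> ` (A \<inter> U)"
    using chart_inverse(5)[OF M] by fastforce
  finally show ?thesis .
qed

lemma chart_at:
  assumes "smooth_manifold M"
  obtains U \<phi> where "(U, \<phi>) \<in> atlas M" "x \<in> U"
proof -
  have "x \<in> (\<Union>(U, \<phi>)\<in>atlas M. U)"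
    using assms by (simp add: smooth_manifold_def)
  then show ?thesis using that by auto
qed

lemma smooth_fun_on_subset: "smooth_fun_on M U f \<Longrightarrow> V \<subseteq> U \<Longrightarrow> smooth_fun_on M V f"
  unfolding smooth_fun_on_def Cinf_on_def by (fastforce intro: Ck_on_subset)

lemma smooth_fun_on_const: "smooth_fun_on M U (\<lambda>x. c)"
  unfolding smooth_fun_on_def Cinf_on_def comp_def by (auto intro: Ck_on_const)

lemma smooth_fun_on_add:
  "smooth_fun_on M U f \<Longrightarrow> smooth_fun_on M U g \<Longrightarrow> smooth_fun_on M U (\<lambda>x. f x + g x)"
  unfolding smooth_fun_on_def Cinf_on_def comp_def by (fastforce intro: Ck_on_add)

lemma smooth_fun_on_mult:
  "smooth_fun_on M U f \<Longrightarrow> smooth_fun_on M U g \<Longrightarrow> smooth_fun_on M U (\<lambda>x. f x * g x)"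
  unfolding smooth_fun_on_def Cinf_on_def comp_def
  by (fastforce intro: bounded_bilinear.Ck_on_prod[OF bounded_bilinear_mult])

lemma smooth_fun_on_uminus: "smooth_fun_on M U f \<Longrightarrow> smooth_fun_on M U (\<lambda>x. - f x)"
  using smooth_fun_on_mult[OF smooth_fun_on_const[of M U "- 1"]] by simp

lemma smooth_fun_on_diff:
  "smooth_fun_on M U f \<Longrightarrow> smooth_fun_on M U g \<Longrightarrow> smooth_fun_on M U (\<lambda>x. f x - g x)"
  using smooth_fun_on_add[OF _ smooth_fun_on_uminus] by fastforce

lemma smooth_fun_on_powr:
  assumes M: "smooth_manifold M" and f: "smooth_fun_on M U f" and pos: "\<And>x. x \<in> U \<Longrightarrow> f x > 0"
  shows "smooth_fun_on M U (\<lambda>x. f x powr a)"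
proof -
  have "Ck_on k (\<phi> ` (U \<inter> V)) (\<lambda>z. f (inv_into V \<phi> z) powr a)" if V: "(V, \<phi>) \<in> atlas M" for k V \<phi>
  proof (rule Ck_on_compose_real[OF Ck_on_powr])
    show "Ck_on k (\<phi> ` (U \<inter> V)) (\<lambda>z. f (inv_into V \<phi> z))"
      using f V unfolding smooth_fun_on_def Cinf_on_def comp_def by auto
    show "(\<lambda>z. f (inv_into V \<phi> z)) ` \<phi> ` (U \<inter> V) \<subseteq> {0<..}"
      using pos chart_inverse(5)[OF M V] by auto
  qed
  then show ?thesis unfolding smooth_fun_on_def Cinf_on_def comp_def by auto
qed

lemma smooth_fun_on_locally:
  assumes M: "smooth_manifold M"
    and loc: "\<And>x. x \<in> U \<Longrightarrow> \<exists>W h. open W \<and> x \<in> W \<and> smooth_fun_on M W h \<and> (\<forall>y\<in>W. f y = h y)"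
  shows "smooth_fun_on M U f"
proof -
  have "Ck_on k (\<phi> ` (U \<inter> V)) (f \<circ> inv_into V \<phi>)" if V: "(V, \<phi>) \<in> atlas M" for k V \<phi>
  proof (rule Ck_on_locally)
    fix z assume "z \<in> \<phi> ` (U \<inter> V)"
    then obtain x where x: "x \<in> U" "x \<in> V" "z = \<phi> x" by auto
    from loc[OF \<open>x \<in> U\<close>] obtain W h where W: "open W" "x \<in> W" "smooth_fun_on M W h"
      "\<forall>y\<in>W. f y = h y" by blast
    have "Ck_on k (\<phi> ` (W \<inter> V)) (h \<circ> inv_into V \<phi>)"
      using W(3) V unfolding smooth_fun_on_def Cinf_on_def by auto
    moreover have "\<forall>y\<in>\<phi> ` (W \<inter> V). (f \<circ> inv_into V \<phi>) y = (h \<circ> inv_into V \<phi>) y"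
      using W(4) chart_inverse(5)[OF M V] by auto
    ultimately show "\<exists>T g. open T \<and> z \<in> T \<and> Ck_on k T g \<and> (\<forall>y\<in>T. (f \<circ> inv_into V \<phi>) y = g y)"
      using open_chart_image[OF M V W(1)] x W(2) by blast
  qed
  then show ?thesis unfolding smooth_fun_on_def Cinf_on_def by auto
qed

lemma compact_box_image:
  fixes B :: "'e::real_normed_vector set"
  assumes "finite B"
  shows "compact {\<Sum>b\<in>B. c b *\<^sub>R b | c. \<forall>b\<in>B. \<bar>c b\<bar> \<le> R b}"
  using assms
proof (induction B rule: finite_induct)
  case (insert a B)
  have "compact ((\<lambda>t. t *\<^sub>R a) ` {- R a..R a})"
    by (intro compact_continuous_image continuous_intros compact_Icc)
  from compact_sums[OF this insert.IH]
  have "compact {x + y | x y. x \<in> (\<lambda>t. t *\<^sub>R a) ` {- R a..R a} \<and>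
      y \<in> {\<Sum>b\<in>B. c b *\<^sub>R b | c. \<forall>b\<in>B. \<bar>c b\<bar> \<le> R b}}" .
  also have "{x + y | x y. x \<in> (\<lambda>t. t *\<^sub>R a) ` {- R a..R a} \<and>
      y \<in> {\<Sum>b\<in>B. c b *\<^sub>R b | c. \<forall>b\<in>B. \<bar>c b\<bar> \<le> R b}} =
      {\<Sum>b\<in>insert a B. c b *\<^sub>R b | c. \<forall>b\<in>insert a B. \<bar>c b\<bar> \<le> R b}" (is "?L = ?R")
  proof
    show "?L \<subseteq> ?R"
    proof
      fix w assume "w \<in> ?L"
      then obtain t c where w: "w = t *\<^sub>R a + (\<Sum>b\<in>B. c b *\<^sub>R b)" "\<bar>t\<bar> \<le> R a" "\<forall>b\<in>B. \<bar>c b\<bar> \<le> R b"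
        by auto
      have "(\<Sum>b\<in>B. (c(a := t)) b *\<^sub>R b) = (\<Sum>b\<in>B. c b *\<^sub>R b)"
        using insert.hyps by (intro sum.cong) auto
      then have "w = (\<Sum>b\<in>insert a B. (c(a := t)) b *\<^sub>R b)" using w(1) insert.hyps by simp
      moreover have "\<forall>b\<in>insert a B. \<bar>(c(a := t)) b\<bar> \<le> R b" using w by auto
      ultimately show "w \<in> ?R" by blast
    qed
    show "?R \<subseteq> ?L"
    proof
      fix w assume "w \<in> ?R"
      then obtain c where w: "w = c a *\<^sub>R a + (\<Sum>b\<in>B. c b *\<^sub>R b)" "\<bar>c a\<bar> \<le> R a" "\<forall>b\<in>B. \<bar>c b\<bar> \<le> R b"
        using insert.hyps by auto
      then have "c a *\<^sub>R a \<in> (\<lambda>t. t *\<^sub>R a) ` {- R a..R a}" by (intro imageI) auto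
      with w show "w \<in> ?L" by blast
    qed
  qed
  finally show ?case .
qed auto

text \<open>With respect to a finite orthogonal spanning set, a closed ball is contained in the image of a box,
  which is compact.\<close>

lemma compact_cball_finite_span:
  fixes p :: "'e::real_inner"
  assumes "finite B" "span B = (UNIV :: 'e set)"
  shows "compact (cball p r)"
proof -
  obtain C where C: "finite C" "span C = (UNIV :: 'e set)" "pairwise orthogonal C"
    using basis_orthogonal[OF assms(1)] assms(2) by auto
  define K where "K = {\<Sum>b\<in>C. c b *\<^sub>R b | c. \<forall>b\<in>C. \<bar>c b\<bar> \<le> (norm p + r) / norm b}"
  have "compact K" unfolding K_def by (rule compact_box_image[OF C(1)])
  moreover have "cball p r \<subseteq> K"
  proof
    fix w assume "w \<in> cball p r"
    then have w: "norm w \<le> norm p + r"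
      using norm_triangle_sub[of w p] by (simp add: dist_norm norm_minus_commute)
    have "w \<in> span C" using C by simp
    then obtain c0 where c0: "w = (\<Sum>b\<in>C. c0 b *\<^sub>R b)" using span_finite[OF C(1)] by auto
    \<comment> \<open>The coefficient of a zero vector in \<open>C\<close> is arbitrary, hence is replaced by \<open>0\<close>.\<close>
    define c where "c b = (if b = 0 then 0 else c0 b)" for b
    have cw: "w = (\<Sum>b\<in>C. c b *\<^sub>R b)" unfolding c0 c_def by (intro sum.cong) auto
    have "\<bar>c b\<bar> \<le> (norm p + r) / norm b" if b: "b \<in> C" for b
    proof (cases "b = 0")
      case False
      have "w \<bullet> b = (\<Sum>d\<in>C. c d * (d \<bullet> b))" unfolding cw by (simp add: inner_sum_left)
      also have "\<dots> = (\<Sum>d\<in>C. if d = b then c b * (b \<bullet> b) else 0)"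
        using C(3) b by (intro sum.cong) (auto simp: pairwise_def orthogonal_def)
      also have "\<dots> = c b * (norm b * norm b)"
        using b C(1) by (simp add: dot_square_norm power2_eq_square)
      finally have "\<bar>c b\<bar> * norm b * norm b = \<bar>w \<bullet> b\<bar>" by (simp add: abs_mult)
      also have "\<dots> \<le> norm w * norm b" by (rule Cauchy_Schwarz_ineq2)
      finally have "\<bar>c b\<bar> * norm b \<le> norm w" using False by simp
      then show ?thesis using w False by (simp add: field_simps)
    qed (simp add: c_def)
    then show "w \<in> K" unfolding K_def using cw by blast
  qed
  ultimately show ?thesis using compact_Int_closed[of K "cball p r"] by (simp add: Int_absorb1)
qed

text \<open>The bump function is a smooth step of the squared distance in a chart, extended by \<open>0\<close>. The extension
  is smooth because the set \<open>K\<close>, a compact ball in the chart, is closed in the Hausdorff manifold.\<close>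

lemma bump_function:
  fixes M :: "('m::{second_countable_topology,t2_space}, 'e::real_inner, 'z) mfd_scheme"
  assumes M: "smooth_manifold M" and U: "open U" "x \<in> U"
  obtains \<beta> W K where "\<beta> \<in> smooth_funs M" "open W" "x \<in> W" "W \<subseteq> U" "\<And>y. y \<in> W \<Longrightarrow> \<beta> y = 1"
    "closed K" "K \<subseteq> U" "\<And>y. y \<notin> K \<Longrightarrow> \<beta> y = 0"
proof -
  obtain V \<phi> where V: "(V, \<phi>) \<in> atlas M" "x \<in> V" by (rule chart_at[OF M])
  note ch = chart_inverse[OF M V(1)]
  have "open (\<phi> ` (U \<inter> V))" by (rule open_chart_image[OF M V(1) U(1)])
  then obtain r where r: "r > 0" "cball (\<phi> x) r \<subseteq> \<phi> ` (U \<inter> V)"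
    using open_contains_cball U(2) V(2) by blast
  define K where "K = inv_into V \<phi> ` cball (\<phi> x) r"
  have "compact (cball (\<phi> x) r)"
    using M compact_cball_finite_span unfolding smooth_manifold_def by blast
  then have "compact K" unfolding K_def
    by (rule compact_continuous_image[rotated]) (use ch(4) r(2) in \<open>auto intro: continuous_on_subset\<close>)
  then have "closed K" by (rule compact_imp_closed)
  have KUV: "K \<subseteq> U \<inter> V"
  proof
    fix y assume "y \<in> K"
    then obtain z where z: "z \<in> cball (\<phi> x) r" "y = inv_into V \<phi> z" unfolding K_def by auto
    with r(2) obtain w where "w \<in> U \<inter> V" "z = \<phi> w" by blast
    with z ch(5)[of w] show "y \<in> U \<inter> V" by auto
  qed
  obtain b where b: "Cinf_on UNIV b" "\<And>t. t \<le> r\<^sup>2 / 4 \<Longrightarrow> b t = 1" "\<And>t. t \<ge> r\<^sup>2 \<Longrightarrow> b t = (0::real)"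
    using smooth_step_exists[of "r\<^sup>2 / 4" "r\<^sup>2"] r(1) by auto
  define \<beta>V where "\<beta>V y = b ((\<phi> y + - \<phi> x) \<bullet> (\<phi> y + - \<phi> x))" for y
  define \<beta> where "\<beta> y = (if y \<in> V then \<beta>V y else 0)" for y
  have sV: "smooth_fun_on M V \<beta>V"
  proof -
    have "Ck_on k (\<psi> ` (V \<inter> V')) (\<lambda>z. \<beta>V (inv_into V' \<psi> z))" if V': "(V', \<psi>) \<in> atlas M" for k V' \<psi>
    proof -
      have "Cinf_on (\<psi> ` (V' \<inter> V)) (\<phi> \<circ> inv_into V' \<psi>)"
        using M V(1) V' unfolding smooth_manifold_def by blast
      then have "Ck_on k (\<psi> ` (V \<inter> V')) (\<lambda>z. \<phi> (inv_into V' \<psi> z) + - \<phi> x)"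
        unfolding Cinf_on_def comp_def by (intro Ck_on_add Ck_on_const) (simp add: Int_commute)
      then have "Ck_on k (\<psi> ` (V \<inter> V')) (\<lambda>z. (\<phi> (inv_into V' \<psi> z) + - \<phi> x) \<bullet> (\<phi> (inv_into V' \<psi> z) + - \<phi> x))"
        by (intro bounded_bilinear.Ck_on_prod[OF bounded_bilinear_inner])
      moreover have "Ck_on k UNIV b" using b(1) unfolding Cinf_on_def by blast
      ultimately show ?thesis unfolding \<beta>V_def by (rule Ck_on_compose_real[OF _ _ subset_UNIV, rotated])
    qed
    then show ?thesis unfolding smooth_fun_on_def Cinf_on_def comp_def by auto
  qed
  have off: "\<beta> y = 0" if "y \<notin> K" for y
  proof (cases "y \<in> V")
    case True
    have "\<phi> y \<notin> cball (\<phi> x) r"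
      using that ch(5)[OF True] unfolding K_def by (metis image_eqI)
    then have "norm (\<phi> y - \<phi> x) \<ge> r" by (simp add: dist_norm norm_minus_commute)
    then have "r\<^sup>2 \<le> (norm (\<phi> y - \<phi> x))\<^sup>2" using r(1) by (intro power_mono) auto
    then show ?thesis using True b(3) by (simp add: \<beta>_def \<beta>V_def dot_square_norm)
  qed (simp add: \<beta>_def)
  have "smooth_fun_on M UNIV \<beta>"
  proof (rule smooth_fun_on_locally[OF M])
    fix y
    show "\<exists>W h. open W \<and> y \<in> W \<and> smooth_fun_on M W h \<and> (\<forall>z\<in>W. \<beta> z = h z)"
    proof (cases "y \<in> V")
      case True
      then show ?thesis using ch(1) sV by (intro exI[of _ V] exI[of _ \<beta>V]) (auto simp: \<beta>_def)
    next
      case False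
      then show ?thesis using \<open>closed K\<close> off KUV
        by (intro exI[of _ "- K"] exI[of _ "\<lambda>_. 0"]) (auto simp: smooth_fun_on_const)
    qed
  qed
  then have "\<beta> \<in> smooth_funs M" by simp
  define W where "W = V \<inter> \<phi> -` ball (\<phi> x) (r / 2)"
  have "open W" unfolding W_def using ch by (intro continuous_open_preimage) auto
  moreover have "x \<in> W" using V(2) r(1) by (simp add: W_def)
  moreover have "W \<subseteq> U"
  proof
    fix y assume y: "y \<in> W"
    then have "\<phi> y \<in> cball (\<phi> x) r" using r(1) by (simp add: W_def)
    then show "y \<in> U" using y ch(5)[of y] KUV unfolding W_def K_def by (metis IntD1 image_eqI subsetD)
  qed
  moreover have "\<beta> y = 1" if "y \<in> W" for y
  proof -
    have "norm (\<phi> y - \<phi> x) \<le> r / 2" using that by (simp add: W_def dist_norm norm_minus_commute)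
    then have "(norm (\<phi> y - \<phi> x))\<^sup>2 \<le> (r / 2)\<^sup>2" by (intro power_mono) auto
    then show ?thesis using that b(2) by (simp add: \<beta>_def \<beta>V_def W_def dot_square_norm power_divide)
  qed
  ultimately show ?thesis using that[of \<beta> W K] \<open>\<beta> \<in> smooth_funs M\<close> \<open>closed K\<close> KUV off by blast
qed

section \<open>Sections, fibre metrics and orthonormal frames\<close>

lemma vector_bundle_frame:
  assumes "vector_bundle E" "(V, e) \<in> frames E"
  shows "open V" "\<And>i. i < rk E \<Longrightarrow> e i \<in> sections_on E V"
    "\<And>x. x \<in> V \<Longrightarrow> inj_on (\<lambda>i. e i x) {..<rk E}"
    "\<And>x. x \<in> V \<Longrightarrow> independent ((\<lambda>i. e i x) ` {..<rk E})"
    "\<And>x. x \<in> V \<Longrightarrow> span ((\<lambda>i. e i x) ` {..<rk E}) = fibre E x"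
  using assms unfolding vector_bundle_def by blast+

lemma frame_at:
  assumes "vector_bundle E"
  obtains V e where "(V, e) \<in> frames E" "x \<in> V"
proof -
  have "x \<in> (\<Union>(V, e)\<in>frames E. V)"
    using assms by (simp add: vector_bundle_def)
  then show ?thesis using that by auto
qed

lemma subspace_fibre:
  assumes "vector_bundle E"
  shows "subspace (fibre E x)"
  using frame_at[OF assms, of x] vector_bundle_frame(5)[OF assms] subspace_span by metis

lemma vector_bundle_smooth_manifold: "vector_bundle E \<Longrightarrow> smooth_manifold E"
  by (simp add: vector_bundle_def)

lemma sections_on_fibre: "s \<in> sections_on E U \<Longrightarrow> x \<in> U \<Longrightarrow> s x \<in> fibre E x"
  by (auto simp: sections_on_def)

lemma sections_on_coeffs:
  assumes "s \<in> sections_on E U" "(V, e) \<in> frames E"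
  shows "\<exists>c. (\<forall>i<rk E. smooth_fun_on E (U \<inter> V) (c i)) \<and>
    (\<forall>x\<in>U \<inter> V. s x = (\<Sum>i<rk E. c i x *\<^sub>R e i x))"
  using assms unfolding sections_on_def by blast

lemma sections_onI:
  assumes "\<And>x. x \<in> U \<Longrightarrow> s x \<in> fibre E x"
    and "\<And>V e. (V, e) \<in> frames E \<Longrightarrow> \<exists>c. (\<forall>i<rk E. smooth_fun_on E (U \<inter> V) (c i)) \<and>
        (\<forall>x\<in>U \<inter> V. s x = (\<Sum>i<rk E. c i x *\<^sub>R e i x))"
  shows "s \<in> sections_on E U"
  using assms unfolding sections_on_def by blast

lemma sections_on_zero:
  assumes "vector_bundle E"
  shows "(\<lambda>x. 0) \<in> sections_on E U"
  by (rule sections_onI)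
    (auto intro!: exI[of _ "\<lambda>i x. 0"] smooth_fun_on_const subspace_0 subspace_fibre[OF assms])

lemma sections_on_add:
  assumes "vector_bundle E" "s \<in> sections_on E U" "t \<in> sections_on E U"
  shows "(\<lambda>x. s x + t x) \<in> sections_on E U"
proof (rule sections_onI)
  fix V e assume V: "(V, e) \<in> frames E"
  from sections_on_coeffs[OF assms(2) this] obtain c where
    c: "\<And>i. i < rk E \<Longrightarrow> smooth_fun_on E (U \<inter> V) (c i)"
    "\<And>x. x \<in> U \<inter> V \<Longrightarrow> s x = (\<Sum>i<rk E. c i x *\<^sub>R e i x)" by blast
  from sections_on_coeffs[OF assms(3) V] obtain d where
    d: "\<And>i. i < rk E \<Longrightarrow> smooth_fun_on E (U \<inter> V) (d i)"
    "\<And>x. x \<in> U \<inter> V \<Longrightarrow> t x = (\<Sum>i<rk E. d i x *\<^sub>R e i x)" by blast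
  show "\<exists>c. (\<forall>i<rk E. smooth_fun_on E (U \<inter> V) (c i)) \<and>
        (\<forall>x\<in>U \<inter> V. s x + t x = (\<Sum>i<rk E. c i x *\<^sub>R e i x))"
    by (intro exI[of _ "\<lambda>i x. c i x + d i x"])
      (auto simp: c(2) d(2) scaleR_left_distrib sum.distrib intro: smooth_fun_on_add c(1) d(1))
qed (intro subspace_add[OF subspace_fibre[OF assms(1)]] sections_on_fibre[OF assms(2)] sections_on_fibre[OF assms(3)])

lemma sections_on_scaleR:
  assumes "vector_bundle E" "smooth_fun_on E U f" "s \<in> sections_on E U"
  shows "(\<lambda>x. f x *\<^sub>R s x) \<in> sections_on E U"
proof (rule sections_onI)
  fix V e assume V: "(V, e) \<in> frames E"
  from sections_on_coeffs[OF assms(3) this] obtain c where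
    c: "\<And>i. i < rk E \<Longrightarrow> smooth_fun_on E (U \<inter> V) (c i)"
    "\<And>x. x \<in> U \<inter> V \<Longrightarrow> s x = (\<Sum>i<rk E. c i x *\<^sub>R e i x)" by blast
  have "smooth_fun_on E (U \<inter> V) f" by (rule smooth_fun_on_subset[OF assms(2)]) auto
  then show "\<exists>c. (\<forall>i<rk E. smooth_fun_on E (U \<inter> V) (c i)) \<and>
        (\<forall>x\<in>U \<inter> V. f x *\<^sub>R s x = (\<Sum>i<rk E. c i x *\<^sub>R e i x))"
    by (intro exI[of _ "\<lambda>i x. f x * c i x"])
      (auto simp: c(2) scaleR_sum_right intro: smooth_fun_on_mult c(1))
qed (intro subspace_scale[OF subspace_fibre[OF assms(1)]] sections_on_fibre[OF assms(3)])

lemma sections_on_uminus: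
  assumes "vector_bundle E" "s \<in> sections_on E U"
  shows "(\<lambda>x. - s x) \<in> sections_on E U"
  using sections_on_scaleR[OF assms(1) smooth_fun_on_const[of E U "- 1"] assms(2)] by simp

lemma sections_on_diff:
  assumes "vector_bundle E" "s \<in> sections_on E U" "t \<in> sections_on E U"
  shows "(\<lambda>x. s x - t x) \<in> sections_on E U"
  using sections_on_add[OF assms(1,2) sections_on_uminus[OF assms(1,3)]] by simp

lemma sections_on_sum:
  assumes "vector_bundle E" "\<And>i. i \<in> I \<Longrightarrow> s i \<in> sections_on E U"
  shows "(\<lambda>x. \<Sum>i\<in>I. s i x) \<in> sections_on E U"
  using assms(2)
  by (induction I rule: infinite_finite_induct)
    (auto intro: sections_on_zero sections_on_add assms(1))

lemma frame_coeffs_unique: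
  assumes "vector_bundle E" "(V, e) \<in> frames E" "x \<in> V"
    and eq: "(\<Sum>i<rk E. c i *\<^sub>R e i x) = (\<Sum>i<rk E. d i *\<^sub>R e i x)" and i: "i < rk E"
  shows "c i = d i"
proof -
  note fr = vector_bundle_frame[OF assms(1,2)]
  let ?e = "\<lambda>i. e i x" and ?inv = "inv_into {..<rk E} (\<lambda>i. e i x)"
  have inv: "?inv (?e i) = i" if "i < rk E" for i
    using inv_into_f_f[of ?e "{..<rk E}" i] fr(3)[OF assms(3)] that by simp
  have "(\<Sum>v\<in>?e ` {..<rk E}. (c (?inv v) - d (?inv v)) *\<^sub>R v) = (\<Sum>i<rk E. (c i - d i) *\<^sub>R e i x)"
    using fr(3)[OF assms(3)] inv by (subst sum.reindex) (auto intro!: sum.cong)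
  also have "\<dots> = 0" using eq by (simp add: scaleR_left_diff_distrib sum_subtractf)
  finally have "c (?inv (?e i)) - d (?inv (?e i)) = 0"
    using i by (intro independentD[OF fr(4)[OF assms(3)] finite_imageI[OF finite_lessThan] subset_refl]) auto
  then show ?thesis using inv[OF i] by simp
qed

text \<open>Smoothness of a section is a local property: the local coefficients in a frame glue because they
  are unique.\<close>

lemma sections_on_locally:
  assumes E: "vector_bundle E"
    and loc: "\<And>x. x \<in> U \<Longrightarrow> \<exists>W t. open W \<and> x \<in> W \<and> t \<in> sections_on E W \<and> (\<forall>y\<in>W. s y = t y)"
  shows "s \<in> sections_on E U"
proof (rule sections_onI)
  fix x assume "x \<in> U"
  from loc[OF this] obtain W t where "x \<in> W" "t \<in> sections_on E W" "\<forall>y\<in>W. s y = t y" by blast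
  then show "s x \<in> fibre E x" using sections_on_fibre[of t E W x] by simp
next
  fix V e assume V: "(V, e) \<in> frames E"
  define c where "c i y = (SOME c. s y = (\<Sum>i<rk E. c i *\<^sub>R e i y)) i" for i y
  have loc_c: "\<exists>W h. open W \<and> x \<in> W \<and> W \<subseteq> V \<and> (\<forall>i<rk E. smooth_fun_on E W (h i)) \<and>
      (\<forall>y\<in>W. s y = (\<Sum>i<rk E. h i y *\<^sub>R e i y) \<and> (\<forall>i<rk E. c i y = h i y))"
    if "x \<in> U \<inter> V" for x
  proof -
    from loc[of x] that obtain W t where W: "open W" "x \<in> W" "t \<in> sections_on E W"
      "\<forall>y\<in>W. s y = t y" by blast
    from sections_on_coeffs[OF W(3) V] obtain h where
      h: "\<And>i. i < rk E \<Longrightarrow> smooth_fun_on E (W \<inter> V) (h i)"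
      "\<And>x. x \<in> W \<inter> V \<Longrightarrow> t x = (\<Sum>i<rk E. h i x *\<^sub>R e i x)" by blast
    have "s y = (\<Sum>i<rk E. h i y *\<^sub>R e i y) \<and> (\<forall>i<rk E. c i y = h i y)" if y: "y \<in> W \<inter> V" for y
    proof -
      have sy: "s y = (\<Sum>i<rk E. h i y *\<^sub>R e i y)" using y W(4) h(2) by auto
      then have "s y = (\<Sum>i<rk E. c i y *\<^sub>R e i y)"
        unfolding c_def by (rule someI[of "\<lambda>c. s y = (\<Sum>i<rk E. c i *\<^sub>R e i y)" "\<lambda>i. h i y"])
      then have "(\<Sum>i<rk E. c i y *\<^sub>R e i y) = (\<Sum>i<rk E. h i y *\<^sub>R e i y)" using sy by simp
      from frame_coeffs_unique[OF E V _ this] y have "\<forall>i<rk E. c i y = h i y" by blast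
      with sy show ?thesis by blast
    qed
    moreover have "open (W \<inter> V)" using W(1) vector_bundle_frame(1)[OF E V] by (rule open_Int)
    ultimately show ?thesis
      using W(2) that h(1) by (intro exI[of _ "W \<inter> V"] exI[of _ h] conjI ballI) blast+
  qed
  have "smooth_fun_on E (U \<inter> V) (c i)" if "i < rk E" for i
  proof (rule smooth_fun_on_locally[OF vector_bundle_smooth_manifold[OF E]])
    fix x assume "x \<in> U \<inter> V"
    from loc_c[OF this] that
    show "\<exists>W h. open W \<and> x \<in> W \<and> smooth_fun_on E W h \<and> (\<forall>y\<in>W. c i y = h y)" by blast
  qed
  moreover have "s x = (\<Sum>i<rk E. c i x *\<^sub>R e i x)" if "x \<in> U \<inter> V" for x
  proof -
    from loc_c[OF that] obtain W h where "x \<in> W"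
      "\<forall>y\<in>W. s y = (\<Sum>i<rk E. h i y *\<^sub>R e i y) \<and> (\<forall>i<rk E. c i y = h i y)" by blast
    then show ?thesis by simp
  qed
  ultimately show "\<exists>c. (\<forall>i<rk E. smooth_fun_on E (U \<inter> V) (c i)) \<and>
        (\<forall>x\<in>U \<inter> V. s x = (\<Sum>i<rk E. c i x *\<^sub>R e i x))" by blast
qed

text \<open>A section over an open set agrees near each point of it with a global section.\<close>

lemma section_extension:
  assumes E: "vector_bundle E" and s: "s \<in> sections_on E U" and U: "open U" "x \<in> U"
  obtains s' where "s' \<in> sections E" "eventually (\<lambda>y. s' y = s y) (nhds x)"
proof -
  obtain \<beta> W K where b: "\<beta> \<in> smooth_funs E" "open W" "x \<in> W" "W \<subseteq> U" "\<And>y. y \<in> W \<Longrightarrow> \<beta> y = 1"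
    "closed K" "K \<subseteq> U" "\<And>y. y \<notin> K \<Longrightarrow> \<beta> y = 0"
    using bump_function[OF vector_bundle_smooth_manifold[OF E] U] by metis
  define s' where "s' y = (if y \<in> U then \<beta> y *\<^sub>R s y else 0)" for y
  have "s' \<in> sections E"
  proof (rule sections_on_locally[OF E])
    fix y
    show "\<exists>W t. open W \<and> y \<in> W \<and> t \<in> sections_on E W \<and> (\<forall>z\<in>W. s' z = t z)"
    proof (cases "y \<in> U")
      case True
      have "(\<lambda>z. \<beta> z *\<^sub>R s z) \<in> sections_on E U"
        using b(1) by (auto intro!: sections_on_scaleR[OF E _ s] intro: smooth_fun_on_subset)
      with True U show ?thesis
        by (intro exI[of _ U] exI[of _ "\<lambda>z. \<beta> z *\<^sub>R s z"]) (auto simp: s'_def)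
    next
      case False
      then show ?thesis using b(6,7,8)
        by (intro exI[of _ "- K"] exI[of _ "\<lambda>_. 0"]) (auto simp: s'_def sections_on_zero[OF E])
    qed
  qed
  moreover have "eventually (\<lambda>y. s' y = s y) (nhds x)"
    using b(2-5) unfolding eventually_nhds s'_def by (intro exI[of _ W]) auto
  ultimately show ?thesis by (rule that)
qed

lemma riemannian_metric_bilinear:
  assumes E: "vector_bundle E" and g: "riemannian_metric E g"
    and u: "u \<in> fibre E x" and v: "v \<in> fibre E x"
  shows "g x u v = g x v u" "g x (c *\<^sub>R u) v = c * g x u v" "g x u (c *\<^sub>R v) = c * g x u v"
    "w \<in> fibre E x \<Longrightarrow> g x (u + w) v = g x u v + g x w v"
    "w \<in> fibre E x \<Longrightarrow> g x u (v + w) = g x u v + g x u w"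
proof -
  note g' = bspec[OF bspec[OF spec[OF conjunct1[OF g[unfolded riemannian_metric_def]]]]]
  note sym = g'[THEN conjunct1] and scale = g'[THEN conjunct2, THEN conjunct1, THEN spec]
    and add = g'[THEN conjunct2, THEN conjunct2, THEN bspec]
  note sub = subspace_add[OF subspace_fibre[OF E]] subspace_scale[OF subspace_fibre[OF E]]
  show "g x u v = g x v u" by (rule sym[OF u v])
  show "g x (c *\<^sub>R u) v = c * g x u v" by (rule scale[OF u v])
  have "g x u (c *\<^sub>R v) = g x (c *\<^sub>R v) u" by (rule sym[OF u sub(2)[OF v]])
  also have "\<dots> = c * g x v u" by (rule scale[OF v u])
  finally show "g x u (c *\<^sub>R v) = c * g x u v" by (simp only: sym[OF u v])
  assume w: "w \<in> fibre E x"
  show "g x (u + w) v = g x u v + g x w v" by (rule add[OF u v w])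
  have "g x u (v + w) = g x (v + w) u" by (rule sym[OF u sub(1)[OF v w]])
  also have "\<dots> = g x v u + g x w u" by (rule add[OF v u w])
  finally show "g x u (v + w) = g x u v + g x u w" by (simp only: sym[OF u v] sym[OF u w])
qed

lemma riemannian_metric_pos:
  "riemannian_metric E g \<Longrightarrow> u \<in> fibre E x \<Longrightarrow> u \<noteq> 0 \<Longrightarrow> g x u u > 0"
  by (simp add: riemannian_metric_def)

lemma riemannian_metric_zero:
  assumes "vector_bundle E" "riemannian_metric E g" "v \<in> fibre E x"
  shows "g x 0 v = 0" "g x v 0 = 0"
  using riemannian_metric_bilinear(2,3)[OF assms(1,2,3,3), of 0] by simp_all

lemma riemannian_metric_uminus_diff:
  assumes E: "vector_bundle E" and g: "riemannian_metric E g"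
    and u: "u \<in> fibre E x" and v: "v \<in> fibre E x"
  shows "g x (- u) v = - g x u v" "g x u (- v) = - g x u v"
    "w \<in> fibre E x \<Longrightarrow> g x (u - w) v = g x u v - g x w v"
    "w \<in> fibre E x \<Longrightarrow> g x u (v - w) = g x u v - g x u w"
proof -
  note bil = riemannian_metric_bilinear[OF E g]
  show neg: "g x (- u) v = - g x u v" "g x u (- v) = - g x u v"
    using bil(2,3)[OF u v, of "- 1"] by simp_all
  show "g x (u - w) v = g x u v - g x w v" "g x u (v - w) = g x u v - g x u w" if "w \<in> fibre E x"
    using bil(4)[OF u v, of "- w"] bil(5)[OF u v, of "- w"] subspace_neg[OF subspace_fibre[OF E] that]
      bil(2)[OF that v, of "- 1"] bil(3)[OF u that, of "- 1"] by simp_all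
qed

lemma riemannian_metric_sum:
  assumes E: "vector_bundle E" and g: "riemannian_metric E g"
    and u: "\<And>i. i \<in> I \<Longrightarrow> u i \<in> fibre E x" and v: "v \<in> fibre E x"
  shows "g x (\<Sum>i\<in>I. u i) v = (\<Sum>i\<in>I. g x (u i) v)"
  using u
proof (induction I rule: infinite_finite_induct)
  case (insert a I)
  have "(\<Sum>i\<in>I. u i) \<in> fibre E x"
    using insert.prems by (intro subspace_sum[OF subspace_fibre[OF E]]) auto
  with insert show ?case by (simp add: riemannian_metric_bilinear(4)[OF E g _ v])
qed (simp_all add: riemannian_metric_zero[OF E g v])

lemma riemannian_metric_smooth:
  "riemannian_metric E g \<Longrightarrow> open U \<Longrightarrow> s \<in> sections_on E U \<Longrightarrow> t \<in> sections_on E U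
    \<Longrightarrow> smooth_fun_on E U (\<lambda>x. g x (s x) (t x))"
  by (simp add: riemannian_metric_def)

text \<open>Gram--Schmidt orthonormalization of the first \<open>k\<close> members of a frame, by induction on \<open>k\<close>: the next
  member is made orthogonal to its predecessors and then normalized. The coefficients are smooth,
  so the result consists of sections. That the spans agree keeps the next member nonzero.\<close>

lemma gram_schmidt_frame:
  assumes E: "vector_bundle E" and g: "riemannian_metric E g" and V: "(V, e) \<in> frames E"
    and k: "k \<le> rk E"
  shows "\<exists>q. (\<forall>i<k. q i \<in> sections_on E V) \<and>
    (\<forall>x\<in>V. (\<forall>i<k. \<forall>j<k. g x (q i x) (q j x) = (if i = j then 1 else 0)) \<and>
      span ((\<lambda>i. q i x) ` {..<k}) = span ((\<lambda>i. e i x) ` {..<k}))"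
  using k
proof (induction k)
  case 0
  then show ?case by auto
next
  case (Suc k)
  note fr = vector_bundle_frame[OF E V]
  have "k \<le> rk E" using Suc.prems by simp
  from Suc.IH[OF this] obtain q where Q: "\<forall>i<k. q i \<in> sections_on E V"
    "\<forall>x\<in>V. (\<forall>i<k. \<forall>j<k. g x (q i x) (q j x) = (if i = j then 1 else 0)) \<and>
      span ((\<lambda>i. q i x) ` {..<k}) = span ((\<lambda>i. e i x) ` {..<k})" by blast
  then have q: "\<And>i. i < k \<Longrightarrow> q i \<in> sections_on E V"
    and orth: "\<And>x i j. x \<in> V \<Longrightarrow> i < k \<Longrightarrow> j < k \<Longrightarrow> g x (q i x) (q j x) = (if i = j then 1 else 0)"
    and span: "\<And>x. x \<in> V \<Longrightarrow> span ((\<lambda>i. q i x) ` {..<k}) = span ((\<lambda>i. e i x) ` {..<k})"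
    by blast+
  have kr: "k < rk E" using Suc.prems by simp
  define pr where "pr x = (\<Sum>i<k. g x (e k x) (q i x) *\<^sub>R q i x)" for x
  define v where "v x = e k x - pr x" for x
  define c where "c x = g x (v x) (v x) powr (- 1 / 2)" for x
  define q' where "q' = q(k := \<lambda>x. c x *\<^sub>R v x)"
  have "(\<lambda>x. g x (e k x) (q i x) *\<^sub>R q i x) \<in> sections_on E V" if "i \<in> {..<k}" for i
  proof (rule sections_on_scaleR[OF E])
    show "q i \<in> sections_on E V" using that q by simp
    then show "smooth_fun_on E V (\<lambda>x. g x (e k x) (q i x))"
      by (rule riemannian_metric_smooth[OF g fr(1) fr(2)[OF kr]])
  qed
  then have pr: "pr \<in> sections_on E V" unfolding pr_def by (rule sections_on_sum[OF E])
  have v: "v \<in> sections_on E V" unfolding v_def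
    by (rule sections_on_diff[OF E fr(2)[OF kr] pr])
  have fib: "e k x \<in> fibre E x" "pr x \<in> fibre E x" "v x \<in> fibre E x" "\<And>i. i < k \<Longrightarrow> q i x \<in> fibre E x"
    if "x \<in> V" for x
    using sections_on_fibre[OF fr(2)[OF kr] that] sections_on_fibre[OF pr that]
      sections_on_fibre[OF v that] sections_on_fibre[OF q that] by simp_all
  have pr_span: "pr x \<in> span ((\<lambda>i. q i x) ` {..<k})" for x
    unfolding pr_def by (intro span_sum span_scale span_base) auto
  have v0: "v x \<noteq> 0" if x: "x \<in> V" for x
  proof
    assume "v x = 0"
    then have "e k x \<in> span ((\<lambda>i. e i x) ` {..<k})"
      using pr_span[of x] span[OF x] by (simp add: v_def)
    moreover have "(\<lambda>i. e i x) ` {..<k} \<subseteq> (\<lambda>i. e i x) ` {..<rk E} - {e k x}"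
    proof
      fix w assume "w \<in> (\<lambda>i. e i x) ` {..<k}"
      then obtain i where "i < k" "w = e i x" by auto
      then show "w \<in> (\<lambda>i. e i x) ` {..<rk E} - {e k x}"
        using inj_onD[OF fr(3)[OF x], of i k] kr by auto
    qed
    ultimately have "e k x \<in> span ((\<lambda>i. e i x) ` {..<rk E} - {e k x})"
      using span_mono by blast
    then show False using fr(4)[OF x] kr unfolding dependent_def by blast
  qed
  have gv: "g x (v x) (v x) > 0" if "x \<in> V" for x
    using riemannian_metric_pos[OF g fib(3)[OF that] v0[OF that]] .
  have c: "c x * c x * g x (v x) (v x) = 1" "c x > 0" if "x \<in> V" for x
  proof -
    have "c x * c x * g x (v x) (v x) = g x (v x) (v x) powr (- 1 / 2 + - 1 / 2) * g x (v x) (v x)"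
      by (simp only: c_def powr_add)
    also have "\<dots> = 1" using gv[OF that] by (simp add: powr_minus)
    finally show "c x * c x * g x (v x) (v x) = 1" .
    show "c x > 0" using gv[OF that] by (simp add: c_def)
  qed
  have "smooth_fun_on E V c" unfolding c_def
    by (rule smooth_fun_on_powr[OF vector_bundle_smooth_manifold[OF E]
        riemannian_metric_smooth[OF g fr(1) v v] gv])
  then have cv: "(\<lambda>x. c x *\<^sub>R v x) \<in> sections_on E V" by (rule sections_on_scaleR[OF E _ v])
  have q': "q' i \<in> sections_on E V" if "i < Suc k" for i
  proof (cases "i = k")
    case False
    with that have "i < k" by simp
    with q False show ?thesis by (simp add: q'_def)
  qed (simp add: q'_def cv)
  have vq: "g x (v x) (q j x) = 0" if x: "x \<in> V" and j: "j < k" for x j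
  proof -
    note sc = subspace_scale[OF subspace_fibre[OF E]]
    have "g x (pr x) (q j x) = (\<Sum>i<k. g x (g x (e k x) (q i x) *\<^sub>R q i x) (q j x))"
      unfolding pr_def by (rule riemannian_metric_sum[OF E g]) (use fib(4)[OF x] sc j in auto)
    also have "\<dots> = (\<Sum>i<k. if i = j then g x (e k x) (q j x) else 0)"
      using fib(4)[OF x] j orth[OF x] by (intro sum.cong) (auto simp: riemannian_metric_bilinear(2)[OF E g])
    also have "\<dots> = g x (e k x) (q j x)" using j by simp
    finally show ?thesis
      unfolding v_def using riemannian_metric_uminus_diff(3)[OF E g fib(1)[OF x] fib(4)[OF x j] fib(2)[OF x]] by simp
  qed
  have orth': "g x (q' i x) (q' j x) = (if i = j then 1 else 0)" if x: "x \<in> V" and ij: "i < Suc k" "j < Suc k" for x i j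
  proof -
    note bil = riemannian_metric_bilinear[OF E g] and sc = subspace_scale[OF subspace_fibre[OF E]]
    note f = fib[OF x]
    consider "i < k" "j < k" | "i < k" "j = k" | "i = k" "j < k" | "i = k" "j = k" using ij by linarith
    then show ?thesis
    proof cases
      case 1
      then show ?thesis using orth[OF x] by (simp add: q'_def)
    next
      case 2
      then show ?thesis using bil(3)[OF f(4) f(3)] bil(1)[OF f(4) f(3)] vq[OF x] by (simp add: q'_def)
    next
      case 3
      then show ?thesis using bil(2)[OF f(3) f(4)] vq[OF x] by (simp add: q'_def)
    next
      case 4
      then show ?thesis using bil(2)[OF f(3) sc[OF f(3)]] bil(3)[OF f(3) f(3)] c(1)[OF x] by (simp add: q'_def)
    qed
  qed
  have span': "span ((\<lambda>i. q' i x) ` {..<Suc k}) = span ((\<lambda>i. e i x) ` {..<Suc k})" if x: "x \<in> V" for x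
  proof -
    let ?Q = "(\<lambda>i. q i x) ` {..<k}" and ?F = "(\<lambda>i. e i x) ` {..<k}"
    have Q': "(\<lambda>i. q' i x) ` {..<Suc k} = insert (c x *\<^sub>R v x) ?Q"
      unfolding lessThan_Suc image_insert q'_def by (auto intro!: image_cong)
    have "span (insert (c x *\<^sub>R v x) ?Q) = span (insert (e k x) ?Q)"
    proof (rule span_eq[THEN iffD2], intro conjI insert_subsetI)
      have "v x \<in> span (insert (e k x) ?Q)" unfolding v_def
        by (intro span_diff span_base subsetD[OF span_mono pr_span]) auto
      then show "c x *\<^sub>R v x \<in> span (insert (e k x) ?Q)" by (rule span_scale)
      have "(1 / c x) *\<^sub>R (c x *\<^sub>R v x) + pr x \<in> span (insert (c x *\<^sub>R v x) ?Q)"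
        by (intro span_add span_scale span_base subsetD[OF span_mono pr_span]) auto
      then show "e k x \<in> span (insert (c x *\<^sub>R v x) ?Q)" using c(2)[OF x] by (simp add: v_def)
    qed (auto intro: span_base)
    also have "\<dots> = span (insert (e k x) ?F)"
      using span[OF x] by (simp add: span_insert)
    finally show ?thesis unfolding Q' by (simp add: lessThan_Suc)
  qed
  show ?case
    by (intro exI[of _ q'] conjI ballI allI impI q' orth' span')
qed

lemma orthonormal_frame:
  assumes E: "vector_bundle E" and g: "riemannian_metric E g"
  shows "\<exists>V q. open V \<and> x \<in> V \<and> (\<forall>i<rk E. q i \<in> sections_on E V) \<and>
    (\<forall>y\<in>V. (\<forall>i<rk E. \<forall>j<rk E. g y (q i y) (q j y) = (if i = j then 1 else 0)) \<and>
      span ((\<lambda>i. q i y) ` {..<rk E}) = fibre E y)"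
proof -
  obtain V e where V: "(V, e) \<in> frames E" "x \<in> V" by (rule frame_at[OF E])
  have "\<exists>q. (\<forall>i<rk E. q i \<in> sections_on E V) \<and>
    (\<forall>y\<in>V. (\<forall>i<rk E. \<forall>j<rk E. g y (q i y) (q j y) = (if i = j then 1 else 0)) \<and>
      span ((\<lambda>i. q i y) ` {..<rk E}) = fibre E y)"
    using gram_schmidt_frame[OF E g V(1) order_refl] vector_bundle_frame(5)[OF E V(1)]
    by (simp cong: ball_cong)
  with V(2) vector_bundle_frame(1)[OF E V(1)] show ?thesis by blast
qed

section \<open>The real form of the second fundamental form\<close>

text \<open>An almost Hermitian Lie algebroid together with its Levi-Civita connection.\<close>

locale hermitian_lc =
  fixes E :: "('m::{second_countable_topology,t2_space}, 'e::real_inner, 'v::real_vector) ah_lie_algd"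
    and D :: "('m \<Rightarrow> 'v) \<Rightarrow> ('m \<Rightarrow> 'v) \<Rightarrow> 'm \<Rightarrow> 'v"
  assumes almost_hermitian: "almost_hermitian_lie_algebroid E"
    and levi_civita: "levi_civita E D"
begin

abbreviation "J \<equiv> acs E"
abbreviation "g \<equiv> metric E"

lemma vec_bundle: "vector_bundle E"
  using almost_hermitian by (simp add: almost_hermitian_lie_algebroid_def lie_algebroid_def)

lemma riem: "riemannian_metric E g"
  using almost_hermitian by (simp add: almost_hermitian_lie_algebroid_def)

lemma endo: "bundle_endomorphism E J"
  using almost_hermitian by (simp add: almost_hermitian_lie_algebroid_def)

lemmas fibre_closed =
  subspace_0[OF subspace_fibre[OF vec_bundle]] subspace_add[OF subspace_fibre[OF vec_bundle]]
  subspace_diff[OF subspace_fibre[OF vec_bundle]] subspace_neg[OF subspace_fibre[OF vec_bundle]]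
  subspace_scale[OF subspace_fibre[OF vec_bundle]]

lemmas section_fibre = sections_on_fibre[OF _ UNIV_I, of _ E]

lemma acs_fibre: "u \<in> fibre E x \<Longrightarrow> J x u \<in> fibre E x"
  using endo by (simp add: bundle_endomorphism_def)

lemma acs_scale: "u \<in> fibre E x \<Longrightarrow> J x (c *\<^sub>R u) = c *\<^sub>R J x u"
  using endo by (simp add: bundle_endomorphism_def)

lemma acs_add: "u \<in> fibre E x \<Longrightarrow> v \<in> fibre E x \<Longrightarrow> J x (u + v) = J x u + J x v"
  using endo by (simp add: bundle_endomorphism_def)

lemma acs_uminus: "u \<in> fibre E x \<Longrightarrow> J x (- u) = - J x u"
  using acs_scale[of u x "- 1"] by simp

lemma acs_diff: "u \<in> fibre E x \<Longrightarrow> v \<in> fibre E x \<Longrightarrow> J x (u - v) = J x u - J x v"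
  using acs_add[of u x "- v"] acs_uminus[of v x] fibre_closed(4)[of v x] by simp

lemma acs_zero: "J x 0 = 0"
  using acs_scale[OF fibre_closed(1), of x 0] by simp

lemma acs_acs: "u \<in> fibre E x \<Longrightarrow> J x (J x u) = - u"
  using almost_hermitian by (simp add: almost_hermitian_lie_algebroid_def)

lemma acs_sections_on: "open U \<Longrightarrow> s \<in> sections_on E U \<Longrightarrow> (\<lambda>x. J x (s x)) \<in> sections_on E U"
  using endo by (simp add: bundle_endomorphism_def)

lemma metric_acs: "u \<in> fibre E x \<Longrightarrow> v \<in> fibre E x \<Longrightarrow> g x (J x u) (J x v) = g x u v"
  using almost_hermitian by (simp add: almost_hermitian_lie_algebroid_def)

lemma metric_acs_left:
  assumes "u \<in> fibre E x" "v \<in> fibre E x"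
  shows "g x (J x u) v = - g x u (J x v)"
proof -
  have "g x (J x (J x u)) (J x v) = g x (J x u) v"
    using assms by (intro metric_acs acs_fibre)
  then show ?thesis
    using assms riemannian_metric_uminus_diff(1)[OF vec_bundle riem assms(1) acs_fibre[OF assms(2)]]
    by (simp add: acs_acs)
qed

lemmas acs_simps = acs_fibre acs_scale acs_add acs_uminus acs_diff acs_acs acs_zero

lemmas sections_add = sections_on_add[OF vec_bundle, where U = UNIV]
lemmas sections_diff = sections_on_diff[OF vec_bundle, where U = UNIV]
lemmas sections_scaleR = sections_on_scaleR[OF vec_bundle, where U = UNIV]
lemmas sections_acs = acs_sections_on[OF open_UNIV]

lemma acs_section_scaleR:
  "s \<in> sections E \<Longrightarrow> (\<lambda>x. J x (f x *\<^sub>R s x)) = (\<lambda>x. f x *\<^sub>R J x (s x))"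
  by (simp add: acs_scale section_fibre)

lemma acs_section_add:
  "s \<in> sections E \<Longrightarrow> t \<in> sections E \<Longrightarrow> (\<lambda>x. J x (s x + t x)) = (\<lambda>x. J x (s x) + J x (t x))"
  by (simp add: acs_add section_fibre)

lemma acs_section_acs: "s \<in> sections E \<Longrightarrow> (\<lambda>x. J x (J x (s x))) = (\<lambda>x. - s x)"
  by (simp add: acs_acs section_fibre)

lemmas D_bilinear = levi_civita[unfolded levi_civita_def, THEN conjunct1]
  and D_leibniz = levi_civita[unfolded levi_civita_def, THEN conjunct2, THEN conjunct1]
  and D_compatible = levi_civita[unfolded levi_civita_def, THEN conjunct2, THEN conjunct2, THEN conjunct1]
  and D_torsion_free = levi_civita[unfolded levi_civita_def, THEN conjunct2, THEN conjunct2, THEN conjunct2]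

lemma D_sections: "s \<in> sections E \<Longrightarrow> t \<in> sections E \<Longrightarrow> D s t \<in> sections E"
  by (rule conjunct1[OF bspec[OF bspec[OF D_bilinear[unfolded bilinear_on_sections_def]]]])

lemma D_fibre: "s \<in> sections E \<Longrightarrow> t \<in> sections E \<Longrightarrow> D s t x \<in> fibre E x"
  using section_fibre[OF D_sections] .

lemma D_add:
  assumes "s \<in> sections E" "t \<in> sections E" "r \<in> sections E"
  shows "D (\<lambda>x. s x + r x) t x = D s t x + D r t x"
    "D s (\<lambda>x. t x + r x) x = D s t x + D s r x"
proof -
  note D = bspec[OF conjunct2[OF conjunct2[OF bspec[OF bspec[OF
    D_bilinear[unfolded bilinear_on_sections_def] assms(1)] assms(2)]]] assms(3)]
  show "D (\<lambda>x. s x + r x) t x = D s t x + D r t x" by (rule fun_cong[OF conjunct1[OF D]])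
  show "D s (\<lambda>x. t x + r x) x = D s t x + D s r x" by (rule fun_cong[OF conjunct2[OF D]])
qed

lemma D_const:
  assumes "s \<in> sections E" "t \<in> sections E"
  shows "D (\<lambda>x. c *\<^sub>R s x) t x = c *\<^sub>R D s t x" "D s (\<lambda>x. c *\<^sub>R t x) x = c *\<^sub>R D s t x"
proof -
  note D = spec[OF conjunct1[OF conjunct2[OF bspec[OF bspec[OF
    D_bilinear[unfolded bilinear_on_sections_def] assms(1)] assms(2)]]], of c]
  show "D (\<lambda>x. c *\<^sub>R s x) t x = c *\<^sub>R D s t x" by (rule fun_cong[OF conjunct1[OF D]])
  show "D s (\<lambda>x. c *\<^sub>R t x) x = c *\<^sub>R D s t x" by (rule fun_cong[OF conjunct2[OF D]])
qed

lemma D_uminus_right: "s \<in> sections E \<Longrightarrow> t \<in> sections E \<Longrightarrow> D s (\<lambda>x. - t x) x = - D s t x"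
  using D_const(2)[of s t "- 1" x] by simp

lemma D_scaleR:
  assumes "s \<in> sections E" "t \<in> sections E" "f \<in> smooth_funs E"
  shows "D (\<lambda>x. f x *\<^sub>R s x) t x = f x *\<^sub>R D s t x"
    "D s (\<lambda>x. f x *\<^sub>R t x) x = anchor E x (s x) f *\<^sub>R t x + f x *\<^sub>R D s t x"
proof -
  note D = bspec[OF bspec[OF bspec[OF D_leibniz assms(1)] assms(2)] assms(3)]
  show "D (\<lambda>x. f x *\<^sub>R s x) t x = f x *\<^sub>R D s t x" by (rule fun_cong[OF conjunct1[OF D]])
  show "D s (\<lambda>x. f x *\<^sub>R t x) x = anchor E x (s x) f *\<^sub>R t x + f x *\<^sub>R D s t x"
    by (rule fun_cong[OF conjunct2[OF D]])
qed

lemma D_metric: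
  "r \<in> sections E \<Longrightarrow> s \<in> sections E \<Longrightarrow> t \<in> sections E \<Longrightarrow>
    anchor E x (r x) (\<lambda>y. g y (s y) (t y)) = g x (D r s x) (t x) + g x (s x) (D r t x)"
  by (rule spec[OF bspec[OF bspec[OF bspec[OF D_compatible]]]])

lemma D_torsion:
  "s \<in> sections E \<Longrightarrow> t \<in> sections E \<Longrightarrow> bracket E s t x = D s t x - D t s x"
  by (rule fun_cong[OF bspec[OF bspec[OF D_torsion_free]], symmetric])

text \<open>The tensor \<open>J (D\<^sub>a J) b\<close>. In \<open>b\<close> it is linear over the smooth functions, because the derivatives of
  a factor of \<open>b\<close> in the two summands cancel by \<open>J\<^sup>2 = - 1\<close>.\<close>

definition K :: "('m \<Rightarrow> 'v) \<Rightarrow> ('m \<Rightarrow> 'v) \<Rightarrow> 'm \<Rightarrow> 'v" where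
  "K a b x = D a b x + J x (D a (\<lambda>y. J y (b y)) x)"

lemma K_sections: "a \<in> sections E \<Longrightarrow> b \<in> sections E \<Longrightarrow> K a b \<in> sections E"
  unfolding K_def by (intro sections_add sections_acs D_sections)

lemma K_fibre: "a \<in> sections E \<Longrightarrow> b \<in> sections E \<Longrightarrow> K a b x \<in> fibre E x"
  using section_fibre[OF K_sections] .

lemma K_add:
  assumes "a \<in> sections E" "b \<in> sections E" "c \<in> sections E"
  shows "K (\<lambda>x. a x + c x) b x = K a b x + K c b x" "K a (\<lambda>x. b x + c x) x = K a b x + K a c x"
  using assms unfolding K_def
  by (simp_all add: acs_section_add D_add sections_acs acs_add D_fibre)

lemma K_scaleR:
  assumes "a \<in> sections E" "b \<in> sections E" "f \<in> smooth_funs E"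
  shows "K (\<lambda>x. f x *\<^sub>R a x) b x = f x *\<^sub>R K a b x" "K a (\<lambda>x. f x *\<^sub>R b x) x = f x *\<^sub>R K a b x"
  using assms unfolding K_def
  by (simp_all add: acs_section_scaleR D_scaleR sections_acs acs_simps fibre_closed D_fibre
      section_fibre scaleR_right_distrib)

lemma K_acs_right:
  assumes "a \<in> sections E" "b \<in> sections E"
  shows "K a (\<lambda>x. J x (b x)) x = - J x (K a b x)"
  using assms unfolding K_def
  by (simp add: acs_section_acs D_uminus_right sections_acs acs_simps fibre_closed D_fibre)

lemma K_metric:
  assumes "a \<in> sections E" "b \<in> sections E" "c \<in> sections E"
  shows "g x (K a b x) (c x) = - g x (b x) (K a c x)"
proof -
  let ?J = "\<lambda>s x. J x (s x)"
  note ss = assms sections_acs[OF assms(2)] sections_acs[OF assms(3)]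
  note fib = section_fibre[OF ss(2), of x] section_fibre[OF ss(3), of x]
    D_fibre[OF ss(1,2), of x] D_fibre[OF ss(1,3), of x] D_fibre[OF ss(1,4), of x] D_fibre[OF ss(1,5), of x]
  note add = riemannian_metric_bilinear(4,5)[OF vec_bundle riem]
  have "(\<lambda>y. g y (?J b y) (?J c y)) = (\<lambda>y. g y (b y) (c y))"
    using assms by (simp add: metric_acs section_fibre)
  then have "g x (D a b x) (c x) + g x (b x) (D a c x)
      = g x (D a (?J b) x) (J x (c x)) + g x (J x (b x)) (D a (?J c) x)"
    using D_metric[OF ss(1,2,3), of x] D_metric[OF ss(1,4,5), of x] by simp
  moreover have "g x (J x (D a (?J b) x)) (c x) = - g x (D a (?J b) x) (J x (c x))"
    "g x (J x (b x)) (D a (?J c) x) = - g x (b x) (J x (D a (?J c) x))"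
    by (rule metric_acs_left; fact fib)+
  ultimately show ?thesis
    unfolding K_def using add(1)[OF fib(3) fib(2) acs_fibre[OF fib(5)]]
      add(2)[OF fib(1) fib(4) acs_fibre[OF fib(6)]] by simp
qed

text \<open>The tensor \<open>Z\<close> is the real form of \<open>B\<^sup>0\<^sup>,\<^sup>1\<close>: up to a constant, \<open>Z a b\<close> is the real part of the
  second fundamental form at \<open>a\<close> and \<open>b\<close>. Expanded, it is
  \<open>D\<^sub>a b + J D\<^sub>a (J b) + J D\<^bsub>J a\<^esub> b - D\<^bsub>J a\<^esub> (J b)\<close>.\<close>

definition Z :: "('m \<Rightarrow> 'v) \<Rightarrow> ('m \<Rightarrow> 'v) \<Rightarrow> 'm \<Rightarrow> 'v" where
  "Z a b x = K a b x + J x (K (\<lambda>y. J y (a y)) b x)"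

lemma Z_sections: "a \<in> sections E \<Longrightarrow> b \<in> sections E \<Longrightarrow> Z a b \<in> sections E"
  unfolding Z_def by (intro sections_add sections_acs K_sections)

lemma Z_fibre: "a \<in> sections E \<Longrightarrow> b \<in> sections E \<Longrightarrow> Z a b x \<in> fibre E x"
  using section_fibre[OF Z_sections] .

lemma Z_add:
  assumes "a \<in> sections E" "b \<in> sections E" "c \<in> sections E"
  shows "Z (\<lambda>x. a x + c x) b x = Z a b x + Z c b x" "Z a (\<lambda>x. b x + c x) x = Z a b x + Z a c x"
  using assms unfolding Z_def
  by (simp_all add: acs_section_add K_add sections_acs acs_add K_fibre)

lemma Z_scaleR:
  assumes "a \<in> sections E" "b \<in> sections E" "f \<in> smooth_funs E"
  shows "Z (\<lambda>x. f x *\<^sub>R a x) b x = f x *\<^sub>R Z a b x" "Z a (\<lambda>x. f x *\<^sub>R b x) x = f x *\<^sub>R Z a b x"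
  using assms unfolding Z_def
  by (simp_all add: acs_section_scaleR K_scaleR sections_acs acs_simps K_fibre scaleR_right_distrib)

lemma K_uminus_left: "a \<in> sections E \<Longrightarrow> b \<in> sections E \<Longrightarrow> K (\<lambda>x. - a x) b x = - K a b x"
  using K_scaleR(1)[of a b "\<lambda>_. - 1" x] by (simp add: smooth_fun_on_const)

lemma Z_acs:
  assumes "a \<in> sections E" "b \<in> sections E"
  shows "Z (\<lambda>x. J x (a x)) b x = - J x (Z a b x)" "Z a (\<lambda>x. J x (b x)) x = - J x (Z a b x)"
  using assms unfolding Z_def
  by (simp_all add: acs_section_acs K_acs_right K_uminus_left sections_acs acs_simps fibre_closed K_fibre)

lemma Z_metric:
  assumes "a \<in> sections E" "b \<in> sections E" "c \<in> sections E"
  shows "g x (Z a b x) (c x) = - g x (b x) (Z a c x)"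
proof -
  let ?J = "\<lambda>s x. J x (s x)"
  note ss = assms sections_acs[OF assms(1)] sections_acs[OF assms(3)]
  note fib = section_fibre[OF ss(2), of x] section_fibre[OF ss(3), of x]
    K_fibre[OF ss(1,2), of x] K_fibre[OF ss(1,3), of x] K_fibre[OF ss(4,2), of x] K_fibre[OF ss(4,3), of x]
  note add = riemannian_metric_bilinear(4,5)[OF vec_bundle riem]
  have "g x (J x (K (?J a) b x)) (c x) = - g x (K (?J a) b x) (J x (c x))"
    by (rule metric_acs_left; fact fib)
  also have "\<dots> = g x (b x) (K (?J a) (?J c) x)" using K_metric[OF ss(4,2,5), of x] by simp
  also have "\<dots> = - g x (b x) (J x (K (?J a) c x))"
    using riemannian_metric_uminus_diff(2)[OF vec_bundle riem fib(1) acs_fibre[OF fib(6)]] K_acs_right[OF ss(4,3)]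
    by simp
  finally show ?thesis
    unfolding Z_def using K_metric[OF assms, of x] add(1)[OF fib(3) fib(2) acs_fibre[OF fib(5)]]
      add(2)[OF fib(1) fib(4) acs_fibre[OF fib(6)]] by simp
qed

text \<open>Linearity over the smooth functions implies that \<open>Z a b x\<close> depends only on the germs of \<open>a\<close> and \<open>b\<close> at
  \<open>x\<close>: multiplication with a bump function at \<open>x\<close> turns sections with equal germs into equal
  sections.\<close>

lemma Z_local:
  assumes ss: "a \<in> sections E" "b \<in> sections E" "a' \<in> sections E" "b' \<in> sections E"
    and eq: "eventually (\<lambda>y. a' y = a y \<and> b' y = b y) (nhds x)"
  shows "Z a' b' x = Z a b x"
proof -
  from eq obtain U where U: "open U" "x \<in> U" "\<And>y. y \<in> U \<Longrightarrow> a' y = a y" "\<And>y. y \<in> U \<Longrightarrow> b' y = b y"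
    unfolding eventually_nhds by blast
  obtain \<beta> W K where b: "\<beta> \<in> smooth_funs E" "x \<in> W" "\<And>y. y \<in> W \<Longrightarrow> \<beta> y = 1" "K \<subseteq> U"
      "\<And>y. y \<notin> K \<Longrightarrow> \<beta> y = 0"
    using bump_function[OF vector_bundle_smooth_manifold[OF vec_bundle] U(1,2)] by metis
  have \<beta>0: "\<beta> y = 0" if "y \<notin> U" for y using b(4,5) that by blast
  have "(\<lambda>y. \<beta> y *\<^sub>R a' y) = (\<lambda>y. \<beta> y *\<^sub>R a y)" "(\<lambda>y. \<beta> y *\<^sub>R b' y) = (\<lambda>y. \<beta> y *\<^sub>R b y)"
    using U(3,4) \<beta>0 by (metis scaleR_zero_left)+
  then have "\<beta> x *\<^sub>R Z a' b' x = \<beta> x *\<^sub>R Z a b' x" "\<beta> x *\<^sub>R Z a b' x = \<beta> x *\<^sub>R Z a b x"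
    using Z_scaleR(1)[OF ss(3,4) b(1), of x] Z_scaleR(1)[OF ss(1,4) b(1), of x]
      Z_scaleR(2)[OF ss(1,4) b(1), of x] Z_scaleR(2)[OF ss(1,2) b(1), of x] by metis+
  then show ?thesis using b(2,3) by simp
qed

lemma nijenhuis_eq_Z:
  assumes "s \<in> sections E" "t \<in> sections E"
  shows "nijenhuis E s t x = Z t s x - Z s t x"
  using assms unfolding nijenhuis_def Let_def Z_def K_def
  by (simp add: D_torsion sections_acs acs_simps fibre_closed D_fibre)

text \<open>If the Nijenhuis tensor vanishes, then \<open>Z\<close> is symmetric. Since \<open>Z a\<close> is skew with respect to the
  metric, \<open>g (Z a b, c)\<close> is then symmetric in its first two and skew in its last two arguments.
  Alternating these two symmetries leads from \<open>g (Z a b, c)\<close> to its negative.\<close>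

lemma nijenhuis_zero_iff_Z_zero:
  "(\<forall>s\<in>sections E. \<forall>t\<in>sections E. nijenhuis E s t = (\<lambda>x. 0)) \<longleftrightarrow>
    (\<forall>a\<in>sections E. \<forall>b\<in>sections E. Z a b = (\<lambda>x. 0))" (is "?N \<longleftrightarrow> ?Z")
proof
  assume ?Z
  then show ?N by (auto simp: nijenhuis_eq_Z fun_eq_iff)
next
  assume N: ?N
  have sym: "Z a b x = Z b a x" if "a \<in> sections E" "b \<in> sections E" for a b x
    using bspec[OF bspec[OF N that(1)] that(2)] nijenhuis_eq_Z[OF that, of x] by simp
  have gsym: "g x (a x) (b x) = g x (b x) (a x)" if "a \<in> sections E" "b \<in> sections E" for a b x
    by (rule riemannian_metric_bilinear(1)[OF vec_bundle riem]) (intro section_fibre that)+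
  have skew: "g x (Z a b x) (c x) = - g x (Z a c x) (b x)"
    if "a \<in> sections E" "b \<in> sections E" "c \<in> sections E" for a b c x
    using Z_metric[OF that] gsym[OF that(2) Z_sections[OF that(1,3)]] by simp
  have zero: "g x (Z a b x) (c x) = 0" if "a \<in> sections E" "b \<in> sections E" "c \<in> sections E" for a b c x
  proof -
    have "g x (Z a b x) (c x) = - g x (Z c a x) (b x)" using skew[OF that] sym[OF that(1,3)] by simp
    also have "\<dots> = g x (Z b c x) (a x)" using skew[OF that(3,1,2)] sym[OF that(3,2)] by simp
    also have "\<dots> = - g x (Z a b x) (c x)" using skew[OF that(2,3,1)] sym[OF that(2,1)] by simp
    finally show ?thesis by simp
  qed
  show ?Z
  proof (intro ballI ext)
    fix a b x assume ab: "a \<in> sections E" "b \<in> sections E"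
    show "Z a b x = 0"
      \<comment> \<open>\<open>Z a b\<close> is itself a global section and serves as third argument.\<close>
      using zero[OF ab Z_sections[OF ab], of x] riemannian_metric_pos[OF riem Z_fibre[OF ab, of x]] by force
  qed
qed

end

section \<open>The second fundamental form on complex sections\<close>

lemma cscale_simps:
  "cscale c (w + z) = cscale c w + cscale c z" "cscale (c + d) w = cscale c w + cscale d w"
  "cscale c (cscale d w) = cscale (c * d) w" "cscale (- c) w = - cscale c w" "cscale c (- w) = - cscale c w"
  "cscale 0 w = 0" "cscale c 0 = 0" "cscale 1 w = w"
  by (simp_all add: cscale_def prod_eq_iff algebra_simps)

lemma cscale_sum_right: "cscale c (\<Sum>i\<in>I. w i) = (\<Sum>i\<in>I. cscale c (w i))"
  by (induction I rule: infinite_finite_induct) (simp_all add: cscale_simps)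

lemma cconj_sum: "cconj (\<Sum>i\<in>I. w i) = (\<Sum>i\<in>I. cconj (w i))"
  by (induction I rule: infinite_finite_induct) (simp_all add: cconj_def prod_eq_iff)

lemma cconj_cscale: "cconj (cscale c w) = cscale (cnj c) (cconj w)"
  by (simp add: cconj_def cscale_def)

context hermitian_lc
begin

lemma csections_onD: "s \<in> csections_on E U \<Longrightarrow> (\<lambda>x. fst (s x)) \<in> sections_on E U"
  "s \<in> csections_on E U \<Longrightarrow> (\<lambda>x. snd (s x)) \<in> sections_on E U"
  by (simp_all add: csections_on_def comp_def)

lemma csections_onI:
  "(\<lambda>x. fst (s x)) \<in> sections_on E U \<Longrightarrow> (\<lambda>x. snd (s x)) \<in> sections_on E U \<Longrightarrow> s \<in> csections_on E U"
  by (simp add: csections_on_def comp_def)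

lemma csections_on_cfibre: "s \<in> csections_on E U \<Longrightarrow> x \<in> U \<Longrightarrow> s x \<in> cfibre E x"
  using sections_on_fibre[OF csections_onD(1)] sections_on_fibre[OF csections_onD(2)]
  by (auto simp: cfibre_def mem_Times_iff)

lemma csections_add:
  "s \<in> csections E \<Longrightarrow> t \<in> csections E \<Longrightarrow> (\<lambda>x. s x + t x) \<in> csections E"
  by (intro csections_onI) (simp_all add: sections_add csections_onD)

lemma csections_cscale:
  assumes "smooth_fun_on E UNIV (\<lambda>x. Re (c x))" "smooth_fun_on E UNIV (\<lambda>x. Im (c x))" "s \<in> csections E"
  shows "(\<lambda>x. cscale (c x) (s x)) \<in> csections E"
  using assms csections_onD[OF assms(3)]
  by (intro csections_onI) (simp_all add: cscale_def sections_add sections_diff sections_scaleR)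

lemma csections_zero: "(\<lambda>x. 0) \<in> csections E"
  by (intro csections_onI) (simp_all add: sections_on_zero[OF vec_bundle])

lemma csections_sum:
  assumes "\<And>i. i \<in> I \<Longrightarrow> s i \<in> csections E"
  shows "(\<lambda>x. \<Sum>i\<in>I. s i x) \<in> csections E"
  using assms
  by (induction I rule: infinite_finite_induct) (simp_all add: csections_zero csections_add)

lemma csections_cconj: "s \<in> csections E \<Longrightarrow> (\<lambda>x. cconj (s x)) \<in> csections E"
  by (intro csections_onI) (simp_all add: cconj_def csections_onD sections_on_uminus[OF vec_bundle])

lemma csections_cacs: "s \<in> csections E \<Longrightarrow> (\<lambda>x. cacs E x (s x)) \<in> csections E"
  by (intro csections_onI) (simp_all add: cacs_def csections_onD sections_acs)

lemma csection_extension: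
  assumes "s \<in> csections_on E U" "open U" "x \<in> U"
  obtains s' where "s' \<in> csections E" "eventually (\<lambda>y. s' y = s y) (nhds x)"
proof -
  obtain p where p: "p \<in> sections E" "eventually (\<lambda>y. p y = fst (s y)) (nhds x)"
    by (rule section_extension[OF vec_bundle csections_onD(1)[OF assms(1)] assms(2,3)])
  obtain q where q: "q \<in> sections E" "eventually (\<lambda>y. q y = snd (s y)) (nhds x)"
    by (rule section_extension[OF vec_bundle csections_onD(2)[OF assms(1)] assms(2,3)])
  show ?thesis
  proof (rule that)
    show "(\<lambda>y. (p y, q y)) \<in> csections E" using p q by (intro csections_onI) simp_all
    show "eventually (\<lambda>y. (p y, q y) = s y) (nhds x)"
      using p(2) q(2) by eventually_elim simp
  qed
qed

text \<open>The projection of \<open>u + i v\<close> to \<open>E\<^sup>0\<^sup>,\<^sup>1\<close> is \<open>(a + i J a) / 2\<close> with \<open>a = u - J v\<close>.\<close>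

definition real01 :: "('m \<Rightarrow> 'v \<times> 'v) \<Rightarrow> 'm \<Rightarrow> 'v" where
  "real01 s x = fst (s x) - J x (snd (s x))"

lemma real01_sections: "s \<in> csections E \<Longrightarrow> real01 s \<in> sections E"
  unfolding real01_def by (intro sections_diff sections_acs csections_onD)

lemma csection_fibre: "s \<in> csections E \<Longrightarrow> fst (s x) \<in> fibre E x" "s \<in> csections E \<Longrightarrow> snd (s x) \<in> fibre E x"
  using section_fibre[OF csections_onD(1)] section_fibre[OF csections_onD(2)] by simp_all

lemma real01_add:
  "s \<in> csections E \<Longrightarrow> t \<in> csections E \<Longrightarrow> real01 (\<lambda>x. s x + t x) = (\<lambda>x. real01 s x + real01 t x)"
  by (simp add: real01_def fun_eq_iff acs_simps csection_fibre)

lemma real01_cscale: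
  "s \<in> csections E \<Longrightarrow> real01 (\<lambda>x. cscale (c x) (s x)) =
    (\<lambda>x. Re (c x) *\<^sub>R real01 s x + (- Im (c x)) *\<^sub>R J x (real01 s x))"
  by (simp add: real01_def cscale_def fun_eq_iff acs_simps csection_fibre fibre_closed algebra_simps)

lemma real01_cacs: "s \<in> csections E \<Longrightarrow> real01 (\<lambda>x. cacs E x (s x)) = (\<lambda>x. J x (real01 s x))"
  by (simp add: real01_def cacs_def fun_eq_iff acs_simps csection_fibre fibre_closed)

lemma B01_eq_Z:
  assumes s: "s \<in> csections E" and t: "t \<in> csections E"
  shows "B01 E D s t x =
    ((1 / 8) *\<^sub>R Z (real01 s) (real01 t) x, - ((1 / 8) *\<^sub>R J x (Z (real01 s) (real01 t) x)))"
proof -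
  let ?a = "real01 s" and ?b = "real01 t"
  let ?Ja = "\<lambda>y. J y (?a y)" and ?Jb = "\<lambda>y. J y (?b y)"
  have proj: "proj01 E y (r y) = ((1 / 2) *\<^sub>R real01 r y, (1 / 2) *\<^sub>R J y (real01 r y))"
    if "r \<in> csections E" for r y
    using csection_fibre[OF that]
    by (simp add: proj01_def cscale_def cacs_def real01_def acs_simps fibre_closed algebra_simps)
  note ss = real01_sections[OF s] real01_sections[OF t] sections_acs[OF real01_sections[OF s]]
    sections_acs[OF real01_sections[OF t]]
  have half: "(\<lambda>y. (1 / 2) *\<^sub>R r y) \<in> sections E" if "r \<in> sections E" for r
    by (rule sections_scaleR[OF smooth_fun_on_const that])
  have quarter: "D (\<lambda>y. (1 / 2) *\<^sub>R p y) (\<lambda>y. (1 / 2) *\<^sub>R q y) x = (1 / 4) *\<^sub>R D p q x"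
    if "p \<in> sections E" "q \<in> sections E" for p q
    using D_const(1)[OF that(1) half[OF that(2)], of "1 / 2" x] D_const(2)[OF that, of "1 / 2" x] by simp
  have conn: "cconnection D (\<lambda>y. proj01 E y (s y)) (\<lambda>y. proj01 E y (t y)) x =
    ((1 / 4) *\<^sub>R (D ?a ?b x - D ?Ja ?Jb x), (1 / 4) *\<^sub>R (D ?a ?Jb x + D ?Ja ?b x))"
    unfolding cconnection_def proj[OF s] proj[OF t] comp_def fst_conv snd_conv
    by (simp add: quarter ss scaleR_diff_right scaleR_add_right)
  show ?thesis
    unfolding B01_def conn using ss D_fibre[OF ss(1,2)] D_fibre[OF ss(1,4)] D_fibre[OF ss(3,2)] D_fibre[OF ss(3,4)]
    by (simp add: proj10_def cscale_def cacs_def Z_def K_def acs_simps fibre_closed algebra_simps)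
qed

lemma B01_zero_iff_Z_zero:
  "(\<forall>s\<in>csections E. \<forall>t\<in>csections E. B01 E D s t = (\<lambda>x. 0)) \<longleftrightarrow>
    (\<forall>a\<in>sections E. \<forall>b\<in>sections E. Z a b = (\<lambda>x. 0))" (is "?B \<longleftrightarrow> ?Z")
proof
  assume ?Z
  then show ?B by (simp add: fun_eq_iff B01_eq_Z real01_sections acs_zero zero_prod_def)
next
  assume B: ?B
  show ?Z
  proof (intro ballI ext)
    fix a b x assume ab: "a \<in> sections E" "b \<in> sections E"
    have c: "(\<lambda>x. (r x, 0)) \<in> csections E" "real01 (\<lambda>x. (r x, 0)) = r" if "r \<in> sections E" for r
      using that by (auto intro!: csections_onI sections_on_zero[OF vec_bundle] simp: real01_def fun_eq_iff acs_zero)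
    have "B01 E D (\<lambda>x. (a x, 0)) (\<lambda>x. (b x, 0)) x = 0"
      using B c(1)[OF ab(1)] c(1)[OF ab(2)] by simp
    then show "Z a b x = 0"
      by (simp add: B01_eq_Z c ab zero_prod_def)
  qed
qed

lemma B01_add:
  assumes "s \<in> csections E" "t \<in> csections E" "r \<in> csections E"
  shows "B01 E D (\<lambda>x. s x + r x) t x = B01 E D s t x + B01 E D r t x"
    "B01 E D s (\<lambda>x. t x + r x) x = B01 E D s t x + B01 E D s r x"
  using assms by (simp_all add: B01_eq_Z csections_add real01_add Z_add real01_sections
      acs_add Z_fibre scaleR_add_right)

lemma B01_cscale:
  assumes c: "smooth_fun_on E UNIV (\<lambda>x. Re (c x))" "smooth_fun_on E UNIV (\<lambda>x. Im (c x))"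
    and s: "s \<in> csections E" and t: "t \<in> csections E"
  shows "B01 E D (\<lambda>x. cscale (c x) (s x)) t x = cscale (c x) (B01 E D s t x)"
    "B01 E D s (\<lambda>x. cscale (c x) (t x)) x = cscale (c x) (B01 E D s t x)"
proof -
  have c': "(\<lambda>x. Re (c x)) \<in> smooth_funs E" "(\<lambda>x. - Im (c x)) \<in> smooth_funs E"
    using c by (simp_all add: smooth_fun_on_uminus)
  note ss = real01_sections[OF s] real01_sections[OF t] sections_acs[OF real01_sections[OF s]]
    sections_acs[OF real01_sections[OF t]]
  note sc = sections_scaleR[OF c'(1)[unfolded mem_Collect_eq]] sections_scaleR[OF c'(2)[unfolded mem_Collect_eq]]
  show "B01 E D (\<lambda>x. cscale (c x) (s x)) t x = cscale (c x) (B01 E D s t x)"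
    unfolding B01_eq_Z[OF csections_cscale[OF c s] t] B01_eq_Z[OF s t] real01_cscale[OF s]
      Z_add(1)[OF sc(1)[OF ss(1)] ss(2) sc(2)[OF ss(3)]] Z_scaleR(1)[OF ss(1,2) c'(1)]
      Z_scaleR(1)[OF ss(3,2) c'(2)] Z_acs(1)[OF ss(1,2)]
    using Z_fibre[OF ss(1,2), of x] by (simp add: cscale_def acs_simps fibre_closed algebra_simps)
  show "B01 E D s (\<lambda>x. cscale (c x) (t x)) x = cscale (c x) (B01 E D s t x)"
    unfolding B01_eq_Z[OF s csections_cscale[OF c t]] B01_eq_Z[OF s t] real01_cscale[OF t]
      Z_add(2)[OF ss(1) sc(1)[OF ss(2)] sc(2)[OF ss(4)]] Z_scaleR(2)[OF ss(1,2) c'(1)]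
      Z_scaleR(2)[OF ss(1,4) c'(2)] Z_acs(2)[OF ss(1,2)]
    using Z_fibre[OF ss(1,2), of x] by (simp add: cscale_def acs_simps fibre_closed algebra_simps)
qed

lemma B01_cacs:
  assumes s: "s \<in> csections E" and t: "t \<in> csections E"
  shows "B01 E D (\<lambda>x. cacs E x (s x)) t x = cscale (- \<i>) (B01 E D s t x)"
    "B01 E D s (\<lambda>x. cacs E x (t x)) x = cscale (- \<i>) (B01 E D s t x)"
  using s t by (simp_all add: B01_eq_Z csections_cacs real01_cacs Z_acs real01_sections cscale_def
      acs_simps Z_fibre fibre_closed)

lemma B01_zero:
  assumes "s \<in> csections E"
  shows "B01 E D (\<lambda>x. 0) s x = 0" "B01 E D s (\<lambda>x. 0) x = 0"
  using B01_cscale[of "\<lambda>x. 0" s s x] assms by (simp_all add: smooth_fun_on_const cscale_simps)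

lemma B01_sum_left:
  assumes "\<And>i. i \<in> I \<Longrightarrow> s i \<in> csections E" "t \<in> csections E"
  shows "B01 E D (\<lambda>x. \<Sum>i\<in>I. s i x) t x = (\<Sum>i\<in>I. B01 E D (s i) t x)"
  using assms(1)
  by (induction I rule: infinite_finite_induct) (simp_all add: B01_zero B01_add csections_sum assms(2))

lemma B01_sum_right:
  assumes "\<And>i. i \<in> I \<Longrightarrow> t i \<in> csections E" "s \<in> csections E"
  shows "B01 E D s (\<lambda>x. \<Sum>i\<in>I. t i x) x = (\<Sum>i\<in>I. B01 E D s (t i) x)"
  using assms(1)
  by (induction I rule: infinite_finite_induct) (simp_all add: B01_zero B01_add csections_sum assms(2))

lemma B01_germ:
  assumes ss: "s \<in> csections E" "t \<in> csections E" "s' \<in> csections E" "t' \<in> csections E"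
    and eq: "eventually (\<lambda>y. s' y = s y \<and> t' y = t y) (nhds x)"
  shows "B01 E D s' t' x = B01 E D s t x"
proof -
  have "eventually (\<lambda>y. real01 s' y = real01 s y \<and> real01 t' y = real01 t y) (nhds x)"
    using eq by eventually_elim (simp add: real01_def)
  then have "Z (real01 s') (real01 t') x = Z (real01 s) (real01 t) x"
    by (rule Z_local[OF real01_sections[OF ss(1)] real01_sections[OF ss(2)]
          real01_sections[OF ss(3)] real01_sections[OF ss(4)]])
  then show ?thesis by (simp add: B01_eq_Z ss)
qed

text \<open>The second fundamental form of local sections may be computed with any global extensions of their
  germs.\<close>

lemma B01_local_eq:
  assumes "s' \<in> csections E" "t' \<in> csections E" "eventually (\<lambda>y. s' y = s y \<and> t' y = t y) (nhds x)"
  shows "B01_local E D s t x = B01 E D s' t' x"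
  unfolding B01_local_def
proof (rule the_equality)
  show "\<forall>s''\<in>csections E. \<forall>t''\<in>csections E.
      eventually (\<lambda>y. s'' y = s y \<and> t'' y = t y) (nhds x) \<longrightarrow> B01 E D s' t' x = B01 E D s'' t'' x"
  proof (intro ballI impI)
    fix s'' t'' assume c: "s'' \<in> csections E" "t'' \<in> csections E"
      and ev: "eventually (\<lambda>y. s'' y = s y \<and> t'' y = t y) (nhds x)"
    have "eventually (\<lambda>y. s' y = s'' y \<and> t' y = t'' y) (nhds x)"
      using assms(3) ev by eventually_elim simp
    then show "B01 E D s' t' x = B01 E D s'' t'' x" by (rule B01_germ[OF c assms(1,2)])
  qed
next
  fix w assume "\<forall>s''\<in>csections E. \<forall>t''\<in>csections E.
      eventually (\<lambda>y. s'' y = s y \<and> t'' y = t y) (nhds x) \<longrightarrow> w = B01 E D s'' t'' x"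
  then show "w = B01 E D s' t' x" using assms by blast
qed

end

section \<open>The trace over a unitary basis\<close>

lemma self_eq_uminus_imp_zero:
  fixes w :: "'a::real_vector"
  assumes "w = - w"
  shows "w = 0"
proof -
  have "2 *\<^sub>R w = w + w" by (rule scaleR_2)
  also have "\<dots> = 0" using assms by (simp add: eq_neg_iff_add_eq_0)
  finally show ?thesis by simp
qed

context hermitian_lc
begin

lemma cfibreD: "w \<in> cfibre E x \<Longrightarrow> fst w \<in> fibre E x" "w \<in> cfibre E x \<Longrightarrow> snd w \<in> fibre E x"
  by (auto simp: cfibre_def)

lemma cfibre_closed:
  "0 \<in> cfibre E x" "w \<in> cfibre E x \<Longrightarrow> z \<in> cfibre E x \<Longrightarrow> w + z \<in> cfibre E x"
  "w \<in> cfibre E x \<Longrightarrow> cscale c w \<in> cfibre E x" "w \<in> cfibre E x \<Longrightarrow> cacs E x w \<in> cfibre E x"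
  by (auto simp: cfibre_def cscale_def cacs_def acs_fibre fibre_closed zero_prod_def)

lemma hmetric_eq:
  assumes "w \<in> cfibre E x" "z \<in> cfibre E x"
  shows "hmetric E x w z = Complex (g x (fst w) (fst z) + g x (snd w) (snd z))
    (g x (snd w) (fst z) - g x (fst w) (snd z))"
  using cfibreD[OF assms(1)] cfibreD[OF assms(2)]
  by (simp add: hmetric_def cmetric_def cconj_def riemannian_metric_uminus_diff[OF vec_bundle riem])

lemma hmetric_add_left:
  assumes "w \<in> cfibre E x" "w' \<in> cfibre E x" "z \<in> cfibre E x"
  shows "hmetric E x (w + w') z = hmetric E x w z + hmetric E x w' z"
  using cfibreD[OF assms(1)] cfibreD[OF assms(2)] cfibreD[OF assms(3)] assms
  by (simp add: hmetric_eq cfibre_closed riemannian_metric_bilinear(4)[OF vec_bundle riem] complex_eq_iff)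

lemma hmetric_cscale_left:
  assumes "w \<in> cfibre E x" "z \<in> cfibre E x"
  shows "hmetric E x (cscale c w) z = c * hmetric E x w z"
proof -
  note w = cfibreD[OF assms(1)] and z = cfibreD[OF assms(2)]
  note bil = riemannian_metric_bilinear[OF vec_bundle riem]
  note sc = fibre_closed(5)[OF w(1)] fibre_closed(5)[OF w(2)]
  show ?thesis
    unfolding hmetric_eq[OF assms] hmetric_eq[OF cfibre_closed(3)[OF assms(1)] assms(2)]
    by (simp add: cscale_def bil(2,4) riemannian_metric_uminus_diff(3)[OF vec_bundle riem] sc w z
        complex_eq_iff algebra_simps)
qed

lemma hmetric_commute:
  assumes "w \<in> cfibre E x" "z \<in> cfibre E x"
  shows "hmetric E x w z = cnj (hmetric E x z w)"
proof -
  note w = cfibreD[OF assms(1)] and z = cfibreD[OF assms(2)]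
  note sym = riemannian_metric_bilinear(1)[OF vec_bundle riem]
  show ?thesis
    unfolding hmetric_eq[OF assms] hmetric_eq[OF assms(2,1)]
    using sym[OF w(1) z(1)] sym[OF w(1) z(2)] sym[OF w(2) z(1)] sym[OF w(2) z(2)]
    by (simp add: complex_eq_iff)
qed

lemma hmetric_cacs_left:
  assumes "w \<in> cfibre E x" "z \<in> cfibre E x"
  shows "hmetric E x (cacs E x w) z = - hmetric E x w (cacs E x z)"
  unfolding hmetric_eq[OF assms(1) cfibre_closed(4)[OF assms(2)]] hmetric_eq[OF cfibre_closed(4)[OF assms(1)] assms(2)]
  using cfibreD[OF assms(1)] cfibreD[OF assms(2)]
  by (simp add: cacs_def metric_acs_left complex_eq_iff)

lemma hmetric_sum_left:
  assumes "\<And>i. i \<in> I \<Longrightarrow> w i \<in> cfibre E x" "z \<in> cfibre E x"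
  shows "hmetric E x (\<Sum>i\<in>I. w i) z = (\<Sum>i\<in>I. hmetric E x (w i) z)"
proof -
  have z: "hmetric E x 0 z = 0"
    using hmetric_cscale_left[OF cfibre_closed(1) assms(2), of 0] by (simp add: cscale_simps)
  have "(\<Sum>i\<in>I. w i) \<in> cfibre E x \<and> hmetric E x (\<Sum>i\<in>I. w i) z = (\<Sum>i\<in>I. hmetric E x (w i) z)"
    using assms(1)
    by (induction I rule: infinite_finite_induct) (simp_all add: z cfibre_closed hmetric_add_left assms(2))
  then show ?thesis by simp
qed

lemma unitary_expansion:
  fixes n :: nat
  assumes f: "\<And>a. a < n \<Longrightarrow> f a \<in> cfibre E x"
    and orth: "\<And>a b. a < n \<Longrightarrow> b < n \<Longrightarrow> hmetric E x (f a) (f b) = (if a = b then 1 else 0)"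
    and span: "\<exists>c. w = (\<Sum>a<n. cscale (c a) (f a))"
  shows "w = (\<Sum>a<n. cscale (hmetric E x w (f a)) (f a))"
proof -
  from span obtain c where w: "w = (\<Sum>a<n. cscale (c a) (f a))" by blast
  have "hmetric E x w (f b) = c b" if b: "b < n" for b
  proof -
    have "hmetric E x w (f b) = (\<Sum>a<n. hmetric E x (cscale (c a) (f a)) (f b))"
      unfolding w by (rule hmetric_sum_left) (use f b in \<open>auto intro: cfibre_closed\<close>)
    also have "\<dots> = (\<Sum>a<n. if a = b then c b else 0)"
      using f b orth by (intro sum.cong) (auto simp: hmetric_cscale_left)
    also have "\<dots> = c b" using b by simp
    finally show ?thesis .
  qed
  then show ?thesis using w by simp
qed

lemma smooth_hmetric:
  assumes s: "s \<in> csections E" and t: "t \<in> csections E"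
  shows "smooth_fun_on E UNIV (\<lambda>x. Re (hmetric E x (s x) (t x)))"
    "smooth_fun_on E UNIV (\<lambda>x. Im (hmetric E x (s x) (t x)))"
  using csections_onD[OF s] csections_onD[OF t]
  by (simp_all add: hmetric_eq[OF csections_on_cfibre[OF s UNIV_I] csections_on_cfibre[OF t UNIV_I]]
      smooth_fun_on_add smooth_fun_on_diff riemannian_metric_smooth[OF riem open_UNIV])

text \<open>The trace of \<open>B\<^sup>0\<^sup>,\<^sup>1\<close> in a unitary basis. With \<open>m a b = h (J f\<^sub>a, f\<^sub>b)\<close>, a skew-Hermitian matrix, expand
  \<open>J f\<^sub>a\<close> in the first slot and \<open>J\<close> of the conjugate of \<open>f\<^sub>b\<close> in the second: the same double sum is both
  \<open>- i\<close> and \<open>i\<close> times the trace.\<close>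

lemma trace_B01_eq_zero:
  assumes basis: "unitary_local_basis E U f" and x: "x \<in> U"
  shows "(\<Sum>a<rk E. B01_local E D (f a) (\<lambda>y. cconj (f a y)) x) = 0"
proof -
  let ?n = "rk E"
  note basis' = basis[unfolded unitary_local_basis_def]
  note U = basis'[THEN conjunct1] and f = basis'[THEN conjunct2, THEN conjunct1, rule_format]
    and pointwise = basis'[THEN conjunct2, THEN conjunct2, THEN bspec]
  note orth = pointwise[THEN conjunct1, rule_format] and span = pointwise[THEN conjunct2, THEN bspec]
  have "\<forall>a\<in>{..<?n}. \<exists>F. F \<in> csections E \<and> eventually (\<lambda>y. F y = f a y) (nhds x)"
  proof
    fix a assume "a \<in> {..<?n}"
    then obtain F where "F \<in> csections E" "eventually (\<lambda>y. F y = f a y) (nhds x)"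
      using csection_extension[OF f U x, of a] by auto
    then show "\<exists>F. F \<in> csections E \<and> eventually (\<lambda>y. F y = f a y) (nhds x)" by blast
  qed
  from bchoice[OF this] obtain F where
    "\<forall>a\<in>{..<?n}. F a \<in> csections E \<and> eventually (\<lambda>y. F a y = f a y) (nhds x)" by blast
  then have F: "\<And>a. a < ?n \<Longrightarrow> F a \<in> csections E"
    and Fev: "\<And>a. a < ?n \<Longrightarrow> eventually (\<lambda>y. F a y = f a y) (nhds x)" by simp_all
  have ev: "eventually (\<lambda>y. y \<in> U \<and> (\<forall>a\<in>{..<?n}. F a y = f a y)) (nhds x)"
    using U x Fev by (intro eventually_conj eventually_ball_finite) (auto simp: eventually_nhds)
  define m where "m a b y = hmetric E y (cacs E y (F a y)) (F b y)" for a b y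
  define G where "G a y = cconj (F a y)" for a y
  define S where "S a b = B01 E D (F a) (G b) x" for a b
  have G: "G a \<in> csections E" if "a < ?n" for a
    unfolding G_def by (rule csections_cconj[OF F[OF that]])
  have m: "smooth_fun_on E UNIV (\<lambda>y. Re (m a b y))" "smooth_fun_on E UNIV (\<lambda>y. Im (m a b y))"
    "smooth_fun_on E UNIV (\<lambda>y. Re (- m a b y))" "smooth_fun_on E UNIV (\<lambda>y. Im (- m a b y))"
    if "a < ?n" "b < ?n" for a b
    unfolding m_def using smooth_hmetric[OF csections_cacs[OF F[OF that(1)]] F[OF that(2)]]
    by (simp_all add: smooth_fun_on_uminus)
  have Ff: "F a y \<in> cfibre E y" if "a < ?n" for a y
    by (rule csections_on_cfibre[OF F[OF that] UNIV_I])
  have m_skew: "cnj (m b a y) = - m a b y" if "a < ?n" "b < ?n" for a b y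
    using hmetric_cacs_left[OF Ff[OF that(1)] Ff[OF that(2)]]
      hmetric_commute[OF Ff[OF that(1)] cfibre_closed(4)[OF Ff[OF that(2)]]] by (simp add: m_def)
  have exp: "eventually (\<lambda>y. cacs E y (F a y) = (\<Sum>b<?n. cscale (m a b y) (F b y))) (nhds x)" if a: "a < ?n" for a
    using ev
  proof eventually_elim
    case (elim y)
    then have y: "y \<in> U" and Fy: "\<And>b. b < ?n \<Longrightarrow> F b y = f b y" by auto
    have "cacs E y (F a y) \<in> cfibre E y" by (rule cfibre_closed(4)[OF Ff[OF a]])
    from span[OF y this] obtain c where "cacs E y (F a y) = (\<Sum>b<?n. cscale (c b) (f b y))" by blast
    also have "\<dots> = (\<Sum>b<?n. cscale (c b) (F b y))" by (intro sum.cong) (simp_all add: Fy)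
    finally have "\<exists>c. cacs E y (F a y) = (\<Sum>b<?n. cscale (c b) (F b y))" by blast
    from unitary_expansion[OF Ff _ this] show ?case
      unfolding m_def using orth[OF y] Fy by simp
  qed
  have exp_conj: "eventually (\<lambda>y. cacs E y (G b y) = (\<Sum>a<?n. cscale (- m a b y) (G a y))) (nhds x)"
    if b: "b < ?n" for b
    using exp[OF b]
  proof eventually_elim
    case (elim y)
    have "cacs E y (G b y) = cconj (cacs E y (F b y))"
      using cfibreD[OF Ff[OF b]] by (simp add: G_def cacs_def cconj_def acs_uminus)
    also have "\<dots> = (\<Sum>a<?n. cscale (- m a b y) (G a y))"
      unfolding elim cconj_sum cconj_cscale G_def using m_skew b by (intro sum.cong) auto
    finally show ?case .
  qed
  \<comment> \<open>The expansions hold only near \<open>x\<close>, which suffices because the form depends only on germs.\<close>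
  have left: "cscale (- \<i>) (S a a) = (\<Sum>b<?n. cscale (m a b x) (S b a))" if a: "a < ?n" for a
  proof -
    have sc: "(\<lambda>y. cscale (m a b y) (F b y)) \<in> csections E" if "b < ?n" for b
      by (rule csections_cscale[OF m(1,2)[OF a that] F[OF that]])
    have "cscale (- \<i>) (S a a) = B01 E D (\<lambda>y. cacs E y (F a y)) (G a) x"
      unfolding S_def by (rule B01_cacs(1)[OF F[OF a] G[OF a], symmetric])
    also have "\<dots> = B01 E D (\<lambda>y. \<Sum>b<?n. cscale (m a b y) (F b y)) (G a) x"
    proof (rule B01_germ[OF _ G[OF a] csections_cacs[OF F[OF a]] G[OF a]])
      show "(\<lambda>y. \<Sum>b<?n. cscale (m a b y) (F b y)) \<in> csections E"
        by (rule csections_sum) (simp add: sc)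
      show "eventually (\<lambda>y. cacs E y (F a y) = (\<Sum>b<?n. cscale (m a b y) (F b y)) \<and> G a y = G a y) (nhds x)"
        using exp[OF a] by eventually_elim simp
    qed
    also have "\<dots> = (\<Sum>b<?n. B01 E D (\<lambda>y. cscale (m a b y) (F b y)) (G a) x)"
      by (rule B01_sum_left[OF _ G[OF a]]) (simp add: sc)
    also have "\<dots> = (\<Sum>b<?n. cscale (m a b x) (S b a))"
      unfolding S_def by (intro sum.cong refl B01_cscale(1) m) (simp_all add: a F G)
    finally show ?thesis .
  qed
  have right: "cscale (- \<i>) (S b b) = (\<Sum>a<?n. - cscale (m a b x) (S b a))" if b: "b < ?n" for b
  proof -
    have sc: "(\<lambda>y. cscale (- m a b y) (G a y)) \<in> csections E" if "a < ?n" for a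
      by (rule csections_cscale[OF m(3,4)[OF that b] G[OF that]])
    have "cscale (- \<i>) (S b b) = B01 E D (F b) (\<lambda>y. cacs E y (G b y)) x"
      unfolding S_def by (rule B01_cacs(2)[OF F[OF b] G[OF b], symmetric])
    also have "\<dots> = B01 E D (F b) (\<lambda>y. \<Sum>a<?n. cscale (- m a b y) (G a y)) x"
    proof (rule B01_germ[OF F[OF b] _ F[OF b] csections_cacs[OF G[OF b]]])
      show "(\<lambda>y. \<Sum>a<?n. cscale (- m a b y) (G a y)) \<in> csections E"
        by (rule csections_sum) (simp add: sc)
      show "eventually (\<lambda>y. F b y = F b y \<and> cacs E y (G b y) = (\<Sum>a<?n. cscale (- m a b y) (G a y))) (nhds x)"
        using exp_conj[OF b] by eventually_elim simp
    qed
    also have "\<dots> = (\<Sum>a<?n. B01 E D (F b) (\<lambda>y. cscale (- m a b y) (G a y)) x)"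
      by (rule B01_sum_right[OF _ F[OF b]]) (simp add: sc)
    also have "\<dots> = (\<Sum>a<?n. cscale (- m a b x) (S b a))"
      unfolding S_def by (intro sum.cong refl B01_cscale(2) m) (simp_all add: b F G)
    finally show ?thesis by (simp add: cscale_simps)
  qed
  have "cscale (- \<i>) (\<Sum>a<?n. S a a) = (\<Sum>a<?n. \<Sum>b<?n. cscale (m a b x) (S b a))"
    unfolding cscale_sum_right by (intro sum.cong) (simp_all add: left)
  also have "\<dots> = - (\<Sum>b<?n. \<Sum>a<?n. - cscale (m a b x) (S b a))"
    by (subst sum.swap) (simp add: sum_negf)
  also have "\<dots> = - cscale (- \<i>) (\<Sum>b<?n. S b b)"
    unfolding cscale_sum_right by (simp add: right)
  finally have "cscale (- \<i>) (\<Sum>a<?n. S a a) = 0" 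
    by (rule self_eq_uminus_imp_zero)
  then have "cscale \<i> (cscale (- \<i>) (\<Sum>a<?n. S a a)) = 0" by (simp add: cscale_simps(7))
  then have "(\<Sum>a<?n. S a a) = 0" by (simp add: cscale_simps(3,8))
  moreover have "B01_local E D (f a) (\<lambda>y. cconj (f a y)) x = S a a" if a: "a < ?n" for a
    unfolding S_def
  proof (rule B01_local_eq[OF F[OF a] G[OF a]])
    show "eventually (\<lambda>y. F a y = f a y \<and> G a y = cconj (f a y)) (nhds x)"
      using Fev[OF a] by eventually_elim (simp add: G_def)
  qed
  ultimately show ?thesis by simp
qed

text \<open>An orthonormal frame of \<open>E\<close> is a unitary basis of \<open>E\<^sub>\<complex>\<close>.\<close>

lemma unitary_local_basis_exists:
  obtains U f where "x \<in> U" "unitary_local_basis E U f"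
proof -
  obtain V q where V: "open V" "x \<in> V"
    and V': "\<forall>i<rk E. q i \<in> sections_on E V"
      "\<forall>y\<in>V. (\<forall>i<rk E. \<forall>j<rk E. g y (q i y) (q j y) = (if i = j then 1 else 0)) \<and>
        span ((\<lambda>i. q i y) ` {..<rk E}) = fibre E y"
    using orthonormal_frame[OF vec_bundle riem, of x] by blast
  from V' have q: "\<And>i. i < rk E \<Longrightarrow> q i \<in> sections_on E V"
    and orth: "\<And>y i j. y \<in> V \<Longrightarrow> i < rk E \<Longrightarrow> j < rk E \<Longrightarrow> g y (q i y) (q j y) = (if i = j then 1 else 0)"
    and span: "\<And>y. y \<in> V \<Longrightarrow> span ((\<lambda>i. q i y) ` {..<rk E}) = fibre E y" by blast+
  let ?f = "\<lambda>i y. (q i y, 0 :: 'v)"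
  have fc: "?f i \<in> csections_on E V" if "i < rk E" for i
    using q[OF that] by (intro csections_onI) (simp_all add: sections_on_zero[OF vec_bundle])
  have real: "\<exists>c. u = (\<Sum>i<rk E. c i *\<^sub>R q i y)" if y: "y \<in> V" and u: "u \<in> fibre E y" for u y
  proof -
    have "u \<in> span ((\<lambda>i. q i y) ` {..<rk E})" using span[OF y] u by simp
    then show ?thesis
    proof (induction rule: span_induct_alt)
      case base
      then show ?case by (intro exI[of _ "\<lambda>i. 0"]) simp
    next
      case (step r w v)
      from step(1) obtain j where j: "j < rk E" "w = q j y" by auto
      from step(2) obtain c where c: "v = (\<Sum>i<rk E. c i *\<^sub>R q i y)" by auto
      have "(\<Sum>i<rk E. (c i + (if i = j then r else 0)) *\<^sub>R q i y)
          = v + (\<Sum>i<rk E. (if i = j then r *\<^sub>R q j y else 0))"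
        unfolding c sum.distrib[symmetric] by (intro sum.cong) (auto simp: scaleR_left_distrib)
      also have "\<dots> = r *\<^sub>R w + v" using j by simp
      finally show ?case by (intro exI[of _ "\<lambda>i. c i + (if i = j then r else 0)"]) simp
    qed
  qed
  have "unitary_local_basis E V ?f"
    unfolding unitary_local_basis_def
  proof (intro conjI allI impI ballI)
    fix y a b assume y: "y \<in> V" and ab: "a < rk E" "b < rk E"
    note fib = csections_on_cfibre[OF fc[OF ab(1)] y] csections_on_cfibre[OF fc[OF ab(2)] y]
    show "hmetric E y (?f a y) (?f b y) = (if a = b then 1 else 0)"
      using orth[OF y ab] cfibreD[OF fib(1)] cfibreD[OF fib(2)]
      by (simp add: hmetric_eq[OF fib] riemannian_metric_zero[OF vec_bundle riem] complex_eq_iff)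
  next
    fix y w assume y: "y \<in> V" and w: "w \<in> cfibre E y"
    obtain c d where "fst w = (\<Sum>i<rk E. c i *\<^sub>R q i y)" "snd w = (\<Sum>i<rk E. d i *\<^sub>R q i y)"
      using real[OF y cfibreD(1)[OF w]] real[OF y cfibreD(2)[OF w]] by blast
    then have "w = (\<Sum>i<rk E. cscale (Complex (c i) (d i)) (?f i y))"
      by (simp add: cscale_def prod_eq_iff fst_sum snd_sum)
    then show "\<exists>c. w = (\<Sum>a<rk E. cscale (c a) (?f a y))"
      by (rule exI[of _ "\<lambda>i. Complex (c i) (d i)"])
  qed (use V fc in auto)
  with V(2) show ?thesis by (rule that)
qed

text \<open>Vanishing of all traces gives zero as a value of the mean curvature; the existence of a unitary basis
  near \<open>x\<close> makes this value unique.\<close>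

lemma H01_eq_zero: "H01 E D x = 0"
  unfolding H01_def
proof (rule the_equality)
  show "\<forall>U f. x \<in> U \<and> unitary_local_basis E U f \<longrightarrow>
      0 = (\<Sum>a<rk E. B01_local E D (f a) (\<lambda>y. cconj (f a y)) x)"
    by (intro allI impI, elim conjE, rule trace_B01_eq_zero[symmetric])
next
  fix w assume w: "\<forall>U f. x \<in> U \<and> unitary_local_basis E U f \<longrightarrow>
      w = (\<Sum>a<rk E. B01_local E D (f a) (\<lambda>y. cconj (f a y)) x)"
  obtain U f where "x \<in> U" "unitary_local_basis E U f" by (rule unitary_local_basis_exists)
  then have "w = (\<Sum>a<rk E. B01_local E D (f a) (\<lambda>y. cconj (f a y)) x)" by (intro w[rule_format] conjI)
  then show "w = 0" by (simp only: trace_B01_eq_zero[OF \<open>unitary_local_basis E U f\<close> \<open>x \<in> U\<close>])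
qed

end

theorem corollary4p2:
  fixes E :: "('m::{second_countable_topology,t2_space}, 'e::real_inner, 'v::real_vector) ah_lie_algd"
    and D :: "('m \<Rightarrow> 'v) \<Rightarrow> ('m \<Rightarrow> 'v) \<Rightarrow> 'm \<Rightarrow> 'v"
  assumes "almost_hermitian_lie_algebroid E"
    and "levi_civita E D"
  shows "(\<forall>x. H01 E D x = 0) \<and>
    ((\<forall>s\<in>csections E. \<forall>t\<in>csections E. B01 E D s t = (\<lambda>x. 0)) \<longleftrightarrow> hermitian_lie_algebroid E)"
proof -
  interpret hermitian_lc E D by (rule hermitian_lc.intro[OF assms])
  show ?thesis
    unfolding B01_zero_iff_Z_zero nijenhuis_zero_iff_Z_zero[symmetric] hermitian_lie_algebroid_def
    by (simp add: H01_eq_zero almost_hermitian)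
qed

end
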